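(* Let $1\to N\xrightarrow{i}G\xrightarrow{p}\Gamma\to1$ be a short exact sequence of groups. Then \[\dim_{\mathbb{R}}\mathrm{W}(G,N)=\dim_{\mathbb{R}}\mathrm{Im}(\mathbf d\circ\tau_{/b})+\dim_{\mathbb{R}}\Big(\frac{\mathrm{Im}\,c_G^2\cap\mathrm{Im}\,p^*}{\mathrm{Im}(p^*\circ c_\Gamma^2)}\Big).\] In particular, $\dim_{\mathbb{R}}\mathrm{W}(G,N)\le\dim_{\mathbb{R}}\mathrm{Ker}\,c_\Gamma^3+\dim_{\mathbb{R}}\mathrm{H}^2(G)$.
   Context: All cohomology has trivial real coefficients. For a group $H$, $\mathrm{C}^n(H)$ is the space of real functions on $H^n$ with the standard inhomogeneous coboundary $\delta$ (e.g. $\delta\phi(h_1,h_2)=\phi(h_2)-\phi(h_1h_2)+\phi(h_1)$ for $\phi\in\mathrm{C}^1(H)$), $\mathrm{C}_b^n(H)$ the bounded functions, $\mathrm{H}^n$, $\mathrm{H}^n_b$ the cohomologies, $c_H^n\colon\mathrm{H}^n_b(H)\to\mathrm{H}^n(H)$ the comparison map. $\mathrm{C}^*_{/b}(H)=\mathrm{C}^*(H)/\mathrm{C}^*_b(H)$ with cohomology $\mathrm{H}^*_{/b}(H)$; $j$ denotes the quotient $\mathrm{C}^*(H)\to\mathrm{C}^*_{/b}(H)$, and $\mathbf d\colon\mathrm{H}^2_{/b}(\Gamma)\to\mathrm{H}^3_b(\Gamma)$ is the connecting map of $0\to\mathrm{C}_b^*\to\mathrm{C}^*\to\mathrm{C}^*_{/b}\to0$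 (induced by $\delta$). $p^*\colon\mathrm{H}^2(\Gamma)\to\mathrm{H}^2(G)$. $\mathrm{Q}(H)$: homogeneous quasimorphisms on $H$; $\mathrm{Q}(N)^G$: those on $N$ invariant under conjugation by $G$; $\mathrm{H}^1(N)^G$: $G$-invariant homomorphisms $N\to\mathbb{R}$; $i^*\colon\mathrm{Q}(G)\to\mathrm{Q}(N)^G$ is restriction. $\mathrm{W}(G,N)=\mathrm{Q}(N)^G/(\mathrm{H}^1(N)^G+i^*\mathrm{Q}(G))$. The map $\tau_{/b}\colon\mathrm{Q}(N)^G\to\mathrm{H}^2_{/b}(\Gamma)$: choose a set-theoretic section $s\colon\Gamma\to G$ of $p$ with $s(1)=1$, put $\mu_s(g)=\mu(g\cdot(s(p(g)))^{-1})$, and $\tau_{/b}(\mu)=[j(s^*\delta\mu_s)]$ where $(s^*\delta\mu_s)(\gamma_1,\gamma_2)=\delta\mu_s(s(\gamma_1),s(\gamma_2))$ (independent of $s$). *)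

theory Defs
  imports Complex_Main "HOL-Library.Function_Algebras" "HOL-Algebra.Coset"
begin

definition fscale :: "real \<Rightarrow> ('a \<Rightarrow> real) \<Rightarrow> ('a \<Rightarrow> real)" where
  "fscale c f = (\<lambda>x. c * f x)"

definition fadd :: "('a \<Rightarrow> real) \<Rightarrow> ('a \<Rightarrow> real) \<Rightarrow> ('a \<Rightarrow> real)" where
  "fadd f g = (\<lambda>x. f x + g x)"

definition fzero :: "'a \<Rightarrow> real" where
  "fzero = (\<lambda>x. 0)"

definition ssum :: "('a \<Rightarrow> real) set \<Rightarrow> ('a \<Rightarrow> real) set \<Rightarrow> ('a \<Rightarrow> real) set" where
  "ssum A B = {fadd a b | a b. a \<in> A \<and> b \<in> B}"

definition rspan :: "('a \<Rightarrow> real) set \<Rightarrow> ('a \<Rightarrow> real) set" where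
  "rspan = module.span fscale"

definition rindep :: "('a \<Rightarrow> real) set \<Rightarrow> bool" where
  "rindep B \<longleftrightarrow> \<not> module.dependent fscale B"

(* B is a basis of the quotient space V/U (U \<subseteq> V subspaces): B \<subseteq> V is
   linearly independent modulo U and spans V modulo U *)
definition qbasis :: "('a \<Rightarrow> real) set \<Rightarrow> ('a \<Rightarrow> real) set \<Rightarrow> ('a \<Rightarrow> real) set \<Rightarrow> bool" where
  "qbasis V U B \<longleftrightarrow> B \<subseteq> V \<and> rindep B \<and> rspan B \<inter> rspan U \<subseteq> {fzero} \<and> V \<subseteq> rspan (B \<union> U)"

definition qdim :: "('a \<Rightarrow> real) set \<Rightarrow> ('a \<Rightarrow> real) set \<Rightarrow> ('a \<Rightarrow> real) rel" where
  "qdim V U = card_of (SOME B. qbasis V U B)"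

definition cochains :: "('a, 'm) monoid_scheme \<Rightarrow> nat \<Rightarrow> ('a list \<Rightarrow> real) set" where
  "cochains H n = {\<phi>. \<forall>xs. \<phi> xs \<noteq> 0 \<longrightarrow> length xs = n \<and> set xs \<subseteq> carrier H}"

definition bdd_fun :: "('b \<Rightarrow> real) \<Rightarrow> bool" where
  "bdd_fun \<phi> \<longleftrightarrow> (\<exists>M. \<forall>x. \<bar>\<phi> x\<bar> \<le> M)"

definition bcochains :: "('a, 'm) monoid_scheme \<Rightarrow> nat \<Rightarrow> ('a list \<Rightarrow> real) set" where
  "bcochains H n = {\<phi> \<in> cochains H n. bdd_fun \<phi>}"

(* (h_1,...,h_{n+1}) \<mapsto> (h_1,...,h_i h_{i+1},...,h_{n+1}),  1 \<le> i \<le> n *)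
definition merge_at :: "('a, 'm) monoid_scheme \<Rightarrow> nat \<Rightarrow> 'a list \<Rightarrow> 'a list" where
  "merge_at H i xs = take (i - 1) xs @ [xs ! (i - 1) \<otimes>\<^bsub>H\<^esub> xs ! i] @ drop (i + 1) xs"

definition cobd :: "('a, 'm) monoid_scheme \<Rightarrow> nat \<Rightarrow> ('a list \<Rightarrow> real) \<Rightarrow> ('a list \<Rightarrow> real)" where
  "cobd H n \<phi> = (\<lambda>xs. if length xs = Suc n \<and> set xs \<subseteq> carrier H then
      \<phi> (tl xs) + (\<Sum>i=1..n. (-1) ^ i * \<phi> (merge_at H i xs)) + (-1) ^ Suc n * \<phi> (butlast xs)
    else 0)"

definition cocycles :: "('a, 'm) monoid_scheme \<Rightarrow> nat \<Rightarrow> ('a list \<Rightarrow> real) set" where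
  "cocycles H n = {\<phi> \<in> cochains H n. cobd H n \<phi> = fzero}"

definition coboundaries :: "('a, 'm) monoid_scheme \<Rightarrow> nat \<Rightarrow> ('a list \<Rightarrow> real) set" where
  "coboundaries H n = (if n = 0 then {fzero} else cobd H (n - 1) ` cochains H (n - 1))"

definition bcocycles :: "('a, 'm) monoid_scheme \<Rightarrow> nat \<Rightarrow> ('a list \<Rightarrow> real) set" where
  "bcocycles H n = {\<phi> \<in> bcochains H n. cobd H n \<phi> = fzero}"

definition bcoboundaries :: "('a, 'm) monoid_scheme \<Rightarrow> nat \<Rightarrow> ('a list \<Rightarrow> real) set" where
  "bcoboundaries H n = (if n = 0 then {fzero} else cobd H (n - 1) ` bcochains H (n - 1))"

definition pullback :: "('a \<Rightarrow> 'b) \<Rightarrow> ('a, 'm) monoid_scheme \<Rightarrow> nat \<Rightarrow> ('b list \<Rightarrow> real) \<Rightarrow> ('a list \<Rightarrow> real)" where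
  "pullback f H n \<phi> = (\<lambda>xs. if length xs = n \<and> set xs \<subseteq> carrier H then \<phi> (map f xs) else 0)"

definition hqm :: "('a, 'm) monoid_scheme \<Rightarrow> ('a \<Rightarrow> real) set" where
  "hqm H = {f. (\<forall>x. x \<notin> carrier H \<longrightarrow> f x = 0)
      \<and> (\<exists>D. \<forall>x\<in>carrier H. \<forall>y\<in>carrier H. \<bar>f (x \<otimes>\<^bsub>H\<^esub> y) - f x - f y\<bar> \<le> D)
      \<and> (\<forall>x\<in>carrier H. \<forall>k::int. f (x [^]\<^bsub>H\<^esub> k) = of_int k * f x)}"

definition homs_R :: "('a, 'm) monoid_scheme \<Rightarrow> ('a \<Rightarrow> real) set" where
  "homs_R H = {f. (\<forall>x. x \<notin> carrier H \<longrightarrow> f x = 0)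
      \<and> (\<forall>x\<in>carrier H. \<forall>y\<in>carrier H. f (x \<otimes>\<^bsub>H\<^esub> y) = f x + f y)}"

definition G_invariant :: "('n, 'x) monoid_scheme \<Rightarrow> ('a, 'y) monoid_scheme \<Rightarrow> ('n \<Rightarrow> 'a) \<Rightarrow> ('n \<Rightarrow> real) \<Rightarrow> bool" where
  "G_invariant N G i f \<longleftrightarrow> (\<forall>g\<in>carrier G. \<forall>n\<in>carrier N. \<forall>m\<in>carrier N.
      i m = g \<otimes>\<^bsub>G\<^esub> i n \<otimes>\<^bsub>G\<^esub> inv\<^bsub>G\<^esub> g \<longrightarrow> f m = f n)"

definition QNG :: "('n, 'x) monoid_scheme \<Rightarrow> ('a, 'y) monoid_scheme \<Rightarrow> ('n \<Rightarrow> 'a) \<Rightarrow> ('n \<Rightarrow> real) set" where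
  "QNG N G i = {f \<in> hqm N. G_invariant N G i f}"

definition H1NG :: "('n, 'x) monoid_scheme \<Rightarrow> ('a, 'y) monoid_scheme \<Rightarrow> ('n \<Rightarrow> 'a) \<Rightarrow> ('n \<Rightarrow> real) set" where
  "H1NG N G i = {f \<in> homs_R N. G_invariant N G i f}"

definition restrQG :: "('n, 'x) monoid_scheme \<Rightarrow> ('a, 'y) monoid_scheme \<Rightarrow> ('n \<Rightarrow> 'a) \<Rightarrow> ('n \<Rightarrow> real) set" where
  "restrQG N G i = (\<lambda>\<psi>. (\<lambda>n. if n \<in> carrier N then \<psi> (i n) else 0)) ` hqm G"

definition mu_s :: "('n, 'x) monoid_scheme \<Rightarrow> ('a, 'y) monoid_scheme \<Rightarrow> ('n \<Rightarrow> 'a) \<Rightarrow> ('a \<Rightarrow> 'c) \<Rightarrow> ('c \<Rightarrow> 'a)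
    \<Rightarrow> ('n \<Rightarrow> real) \<Rightarrow> 'a \<Rightarrow> real" where
  "mu_s N G i p s \<mu> g = \<mu> (the_inv_into (carrier N) i (g \<otimes>\<^bsub>G\<^esub> inv\<^bsub>G\<^esub> (s (p g))))"

definition mu_s_cochain :: "('n, 'x) monoid_scheme \<Rightarrow> ('a, 'y) monoid_scheme \<Rightarrow> ('n \<Rightarrow> 'a) \<Rightarrow> ('a \<Rightarrow> 'c) \<Rightarrow> ('c \<Rightarrow> 'a)
    \<Rightarrow> ('n \<Rightarrow> real) \<Rightarrow> 'a list \<Rightarrow> real" where
  "mu_s_cochain N G i p s \<mu> = (\<lambda>xs. if length xs = 1 \<and> set xs \<subseteq> carrier G then mu_s N G i p s \<mu> (hd xs) else 0)"

(* s^* delta mu_s : a 2-cochain on Gamma, representing tau_/b(mu) in H^2_/b(Gamma) *)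
definition tau_rep :: "('n, 'x) monoid_scheme \<Rightarrow> ('a, 'y) monoid_scheme \<Rightarrow> ('c, 'z) monoid_scheme \<Rightarrow> ('n \<Rightarrow> 'a)
    \<Rightarrow> ('a \<Rightarrow> 'c) \<Rightarrow> ('c \<Rightarrow> 'a) \<Rightarrow> ('n \<Rightarrow> real) \<Rightarrow> 'c list \<Rightarrow> real" where
  "tau_rep N G Gm i p s \<mu> = pullback s Gm 2 (cobd G 1 (mu_s_cochain N G i p s \<mu>))"

(* a representative of d(tau_/b(mu)) in H^3_b(Gamma): delta applied to a representative *)
definition dtau_rep :: "('n, 'x) monoid_scheme \<Rightarrow> ('a, 'y) monoid_scheme \<Rightarrow> ('c, 'z) monoid_scheme \<Rightarrow> ('n \<Rightarrow> 'a)
    \<Rightarrow> ('a \<Rightarrow> 'c) \<Rightarrow> ('c \<Rightarrow> 'a) \<Rightarrow> ('n \<Rightarrow> real) \<Rightarrow> 'c list \<Rightarrow> real" where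
  "dtau_rep N G Gm i p s \<mu> = cobd Gm 2 (tau_rep N G Gm i p s \<mu>)"

end

theory Submission
  imports Defs
begin

text \<open>
  For \<open>\<mu>\<close> in \<open>Q(N)^G\<close> one has \<open>\<tau>(\<mu>)(a, b) = - \<mu>(s(a) s(b) s(ab)^-1)\<close>, and \<open>\<delta> \<mu>_s\<close> is at bounded
  distance from \<open>p^* \<tau>(\<mu>)\<close>, with equality when \<open>\<mu>\<close> is a homomorphism. Let \<open>K\<close> be the kernel of
  \<open>d \<circ> \<tau>\<close>. It contains \<open>U = H^1(N)^G + i^* Q(G)\<close>, so
  \<open>dim W(G, N) = dim Im (d \<circ> \<tau>) + dim (K / U)\<close>.
  For \<open>\<mu>\<close> in \<open>K\<close> some bounded \<open>b\<close> makes \<open>c = \<tau>(\<mu>) - b\<close> a cocycle; its pullback is cohomologous to the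
  bounded cocycle \<open>p^* c - \<delta> \<mu>_s\<close>, and \<open>\<mu> \<mapsto> [p^* c]\<close> induces an isomorphism from \<open>K / U\<close> onto the
  second quotient of the formula. For surjectivity, if \<open>p^* c = \<alpha> + \<delta> \<phi>\<close> with \<open>\<alpha>\<close> bounded, then \<open>\<phi>\<close>
  restricts to a quasimorphism on \<open>N\<close> whose homogenization is a preimage. For injectivity, if
  \<open>p^* c = \<delta> \<phi>\<close>, then \<open>\<phi>\<close> restricts on \<open>N\<close>, up to a constant, to an invariant homomorphism \<open>h\<close>,
  while \<open>\<phi> - \<mu>_s\<close> is a quasimorphism on \<open>G\<close> whose homogenization restricts to \<open>h - \<mu>\<close>.
\<close>

section \<open>Dimensions of quotients\<close>

interpretation fs: vector_space "fscale :: real \<Rightarrow> ('a \<Rightarrow> real) \<Rightarrow> 'a \<Rightarrow> real"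
  by unfold_locales (auto simp: fscale_def algebra_simps)

lemma fadd_eq_plus: "fadd f g = f + g"
  by (auto simp: fadd_def)

lemma fzero_eq_zero: "fzero = 0"
  by (auto simp: fzero_def)

lemma fscale_minus_one: "fscale (-1) f = - f"
  by (auto simp: fscale_def)

lemma ssum_iff: "x \<in> ssum A B \<longleftrightarrow> (\<exists>a\<in>A. \<exists>b\<in>B. x = a + b)"
  by (auto simp: ssum_def fadd_eq_plus)

lemma subspace_ssum:
  assumes "fs.subspace A" "fs.subspace B"
  shows "fs.subspace (ssum A B)"
proof -
  have "ssum A B = {a + b |a b. a \<in> A \<and> b \<in> B}"
    by (simp add: ssum_def fadd_eq_plus)
  then show ?thesis
    using fs.subspace_sums[OF assms] by simp
qed

lemma subset_ssum_left: "fs.subspace B \<Longrightarrow> A \<subseteq> ssum A B"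
  unfolding ssum_iff subset_eq by (metis add.right_neutral fs.subspace_0)

lemma subset_ssum_right: "fs.subspace A \<Longrightarrow> B \<subseteq> ssum A B"
  unfolding ssum_iff subset_eq by (metis add.left_neutral fs.subspace_0)

lemma ssum_least: "fs.subspace C \<Longrightarrow> A \<subseteq> C \<Longrightarrow> B \<subseteq> C \<Longrightarrow> ssum A B \<subseteq> C"
  by (auto simp: ssum_iff subset_eq fs.subspace_add)

lemma ssum_mono_left: "A \<subseteq> A' \<Longrightarrow> ssum A B \<subseteq> ssum A' B"
  by (auto simp: ssum_def)

text \<open>The coordinates of \<open>x\<close> in the basis \<open>A \<union> B\<close> agree with
  those in \<open>A\<close> and with those in \<open>B\<close>, so they are supported on
  \<open>A \<inter> B\<close>, which is empty.\<close>

lemma span_disjoint: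
  assumes "fs.independent (A \<union> B)" "A \<inter> B = {}"
  shows "fs.span A \<inter> fs.span B \<subseteq> {0}"
proof
  fix x assume x: "x \<in> fs.span A \<inter> fs.span B"
  have iA: "fs.independent A" and iB: "fs.independent B"
    using assms(1) fs.independent_mono by blast+
  have eA: "fs.representation (A \<union> B) x = fs.representation A x"
    using fs.representation_extend[OF assms(1)] x by blast
  have eB: "fs.representation (A \<union> B) x = fs.representation B x"
    using fs.representation_extend[OF assms(1)] x by blast
  have "fs.representation A x b = 0" for b
    using eA eB assms(2) fs.representation_ne_zero[of A x b] fs.representation_ne_zero[of B x b]
    by (metis disjoint_iff)
  then show "x \<in> {0}"
    using fs.sum_nonzero_representation_eq[OF iA, of x] x by simp
qed

text \<open>A maximal independent \<open>C\<close> between \<open>A\<close> and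
  \<open>A \<union> B\<close> must contain all of \<open>B\<close>: an omitted \<open>b\<close>
  would be \<open>x + y\<close> with \<open>x\<close> in the span of \<open>A\<close> and
  \<open>y\<close> in that of \<open>B - {b}\<close>; then \<open>x = b - y\<close> lies in both
  spans and vanishes, so \<open>b\<close> depends on \<open>B - {b}\<close>.\<close>

lemma independent_Un:
  assumes A: "fs.independent A" and B: "fs.independent B" and d: "fs.span A \<inter> fs.span B \<subseteq> {0}"
  shows "fs.independent (A \<union> B)"
proof -
  obtain C where C: "A \<subseteq> C" "C \<subseteq> A \<union> B" "fs.independent C" "A \<union> B \<subseteq> fs.span C"
    using fs.maximal_independent_subset_extend[OF _ A, of "A \<union> B"] by auto
  have "b \<in> C" if "b \<in> B" for b
  proof (rule ccontr)
    assume "b \<notin> C"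
    have "fs.span C \<subseteq> fs.span (A \<union> (B - {b}))"
      using C(2) \<open>b \<notin> C\<close> by (intro fs.span_mono) auto
    then have "b \<in> fs.span (A \<union> (B - {b}))"
      using C(4) that by auto
    then obtain x y where xy: "b = x + y" "x \<in> fs.span A" "y \<in> fs.span (B - {b})"
      unfolding fs.span_Un by auto
    have "x = b - y" using xy(1) by simp
    moreover have "y \<in> fs.span B"
      using xy(3) fs.span_mono[of "B - {b}" B] by auto
    ultimately have "x \<in> fs.span B"
      using that by (simp add: fs.span_base fs.span_diff)
    then have "x = 0" using d xy(2) by auto
    then have "b \<in> fs.span (B - {b})" using xy by simp
    then show False using B that fs.dependent_def by blast
  qed
  then have "C = A \<union> B" using C by auto
  then show ?thesis using C by simp
qed

section \<open>Bases of a quotient space and their comparison\<close>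

lemma span_Un_iff: "v \<in> fs.span (A \<union> B) \<longleftrightarrow> (\<exists>x\<in>fs.span A. v - x \<in> fs.span B)"
proof
  assume "\<exists>x\<in>fs.span A. v - x \<in> fs.span B"
  then obtain x where "x \<in> fs.span A" "v - x \<in> fs.span B" by blast
  moreover have "v = x + (v - x)" by simp
  ultimately show "v \<in> fs.span (A \<union> B)" unfolding fs.span_Un by blast
qed (force simp: fs.span_Un)

lemma qbasis_iff:
  assumes "fs.subspace U"
  shows "qbasis V U B \<longleftrightarrow> B \<subseteq> V \<and> fs.independent B \<and> fs.span B \<inter> U \<subseteq> {0}
    \<and> (\<forall>v\<in>V. \<exists>x\<in>fs.span B. v - x \<in> U)"
proof -
  have U: "fs.span U = U" using assms by simp
  show ?thesis
    unfolding qbasis_def rspan_def rindep_def fzero_eq_zero subset_eq[of V] span_Un_iff U by blast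
qed

text \<open>A basis \<open>A\<close> of \<open>U\<close> extends to a basis \<open>C\<close> of
  \<open>V\<close>; the added vectors \<open>C - A\<close> form a basis modulo
  \<open>U\<close>.\<close>

lemma qbasis_exists:
  assumes "fs.subspace U" "fs.subspace V" "U \<subseteq> V"
  obtains B where "qbasis V U B"
proof -
  obtain A where A: "A \<subseteq> U" "fs.independent A" "U \<subseteq> fs.span A"
    using fs.maximal_independent_subset by blast
  obtain C where C: "A \<subseteq> C" "C \<subseteq> V" "fs.independent C" "V \<subseteq> fs.span C"
    using fs.maximal_independent_subset_extend[of A V] A assms by blast
  have sA: "fs.span A = U"
    using A assms(1) by (simp add: fs.span_subspace)
  define B where "B = C - A"
  have CBA: "C = B \<union> A" using C B_def by auto
  have "qbasis V U B"
    unfolding qbasis_iff[OF assms(1)]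
  proof (intro conjI ballI)
    show "B \<subseteq> V" using C B_def by auto
    show "fs.independent B" using C fs.independent_mono B_def by blast
    show "fs.span B \<inter> U \<subseteq> {0}"
    proof -
      have "fs.independent (B \<union> A)" using C(3) CBA by simp
      moreover have "B \<inter> A = {}" unfolding B_def by blast
      ultimately show ?thesis using span_disjoint sA by metis
    qed
    fix v assume "v \<in> V"
    then have "v \<in> fs.span (B \<union> A)" using C CBA by auto
    then show "\<exists>x\<in>fs.span B. v - x \<in> U" unfolding span_Un_iff sA .
  qed
  then show ?thesis by (rule that)
qed

text \<open>\<open>R\<close> is a linear relation, total on \<open>V\<close> and onto
  \<open>V'\<close>, that matches \<open>U\<close> with \<open>U'\<close>; it therefore induces an
  isomorphism of the quotients. A relation rather than a map is used because the maps to be compared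
  are defined on classes, whose representatives involve choices.\<close>

lemma qbasis_bij_betw:
  fixes R :: "('a \<Rightarrow> real) \<Rightarrow> ('b \<Rightarrow> real) \<Rightarrow> bool"
  assumes U: "fs.subspace U" and V: "fs.subspace V"
    and U': "fs.subspace U'" and V': "fs.subspace V'" "U' \<subseteq> V'"
    and R0: "R 0 0"
    and Radd: "\<And>x y x' y'. R x x' \<Longrightarrow> R y y' \<Longrightarrow> R (x + y) (x' + y')"
    and Rscale: "\<And>c x x'. R x x' \<Longrightarrow> R (fscale c x) (fscale c x')"
    and RV: "\<And>x. x \<in> V \<Longrightarrow> \<exists>x'\<in>V'. R x x'"
    and RV': "\<And>x'. x' \<in> V' \<Longrightarrow> \<exists>x\<in>V. R x x'"
    and RU: "\<And>x x'. R x x' \<Longrightarrow> x \<in> V \<Longrightarrow> x' \<in> V' \<Longrightarrow> x \<in> U \<longleftrightarrow> x' \<in> U'"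
    and B: "qbasis V U B" and C: "qbasis V' U' C"
  shows "\<exists>g. bij_betw g B C"
proof -
  interpret vector_space_pair
    "fscale :: real \<Rightarrow> ('a \<Rightarrow> real) \<Rightarrow> 'a \<Rightarrow> real" "fscale :: real \<Rightarrow> ('b \<Rightarrow> real) \<Rightarrow> 'b \<Rightarrow> real" ..
  note Bp = B[unfolded qbasis_iff[OF U]] and Cp = C[unfolded qbasis_iff[OF U']]
  have spB: "fs.span B \<subseteq> V" and spC: "fs.span C \<subseteq> V'"
    using Bp Cp V V'(1) by (simp_all add: fs.span_minimal)
  \<comment> \<open>\<open>S\<close> is the graph of the induced map, read on the complements
    \<open>span B\<close> and \<open>span C\<close>: \<open>c\<close> represents modulo
    \<open>U'\<close> some \<open>R\<close>-partner of \<open>x\<close>.\<close>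
  define S where "S x c \<longleftrightarrow> x \<in> fs.span B \<and> c \<in> fs.span C \<and> (\<exists>v. R x v \<and> v - c \<in> U')" for x c
  have S0: "S 0 0"
    unfolding S_def using R0 U' by (auto simp: fs.span_zero fs.subspace_0 intro!: exI[of _ 0])
  have Sadd: "S (x + y) (x' + y')" if xy: "S x x'" "S y y'" for x y x' y'
  proof -
    obtain v w where "R x v" "v - x' \<in> U'" "R y w" "w - y' \<in> U'"
      using xy unfolding S_def by blast
    then have "R (x + y) (v + w)" "(v - x') + (w - y') \<in> U'"
      using Radd U' fs.subspace_add by blast+
    moreover have "(v - x') + (w - y') = (v + w) - (x' + y')"
      by simp
    ultimately show ?thesis
      using xy unfolding S_def by (metis fs.span_add)
  qed
  have Sscale: "S (fscale c x) (fscale c x')" if x: "S x x'" for c x x'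
  proof -
    obtain v where "R x v" "v - x' \<in> U'"
      using x unfolding S_def by blast
    then have "R (fscale c x) (fscale c v)" "fscale c v - fscale c x' \<in> U'"
      using Rscale U' fs.subspace_scale by (auto simp flip: fs.scale_right_diff_distrib)
    then show ?thesis
      using x unfolding S_def by (metis fs.span_scale)
  qed
  have "\<exists>c. S b c" if "b \<in> B" for b
  proof -
    have "b \<in> V" using Bp that by blast
    from RV[OF this] obtain v where v: "v \<in> V'" "R b v" by blast
    then obtain c where c: "c \<in> fs.span C" "v - c \<in> U'" using Cp by blast
    have "S b c"
      unfolding S_def using v c fs.span_base[OF that] by blast
    then show ?thesis by (rule exI[where P = "S b"])
  qed
  then have f0: "\<forall>b\<in>B. S b (SOME c. S b c)" by (simp add: someI_ex)
  define f0 where "f0 b = (SOME c. S b c)" for b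
  \<comment> \<open>A partner is chosen only for basis vectors and extended linearly;
    \<open>S\<close> is closed under linear combinations, so \<open>S x (f x)\<close> holds on all
    of \<open>span B\<close>.\<close>
  obtain f where lf: "Vector_Spaces.linear fscale fscale f" and fB: "\<And>b. b \<in> B \<Longrightarrow> f b = f0 b"
    using linear_independent_extend[of B f0] Bp by blast
  interpret f: Vector_Spaces.linear fscale fscale f by (rule lf)
  have Sf: "S x (f x)" if "x \<in> fs.span B" for x
    using that
  proof (induction rule: fs.span_induct_alt)
    case base
    show ?case unfolding f.zero by (rule S0)
  next
    case (step c b y)
    then have "S b (f b)" using f0 fB by (simp add: f0_def)
    from Sadd[OF Sscale[OF this] step(2)] show ?case unfolding f.add f.scale .
  qed
  \<comment> \<open>A partner in \<open>U'\<close> forces \<open>x\<close> into \<open>U\<close>,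
    and \<open>span B\<close> meets \<open>U\<close> only in zero. This gives injectivity of
    \<open>f\<close>.\<close>
  have zero_iff: "x = 0" if Sx: "S x 0" for x
  proof -
    obtain v where v: "R x v" "v \<in> U'" and x: "x \<in> fs.span B"
      using Sx unfolding S_def diff_zero by blast
    have "x \<in> V" "v \<in> V'" using x v(2) spB V'(2) by auto
    from RU[OF v(1) this] have "x \<in> U" using v(2) by simp
    then show ?thesis using x Bp by blast
  qed
  have inj: "inj_on f (fs.span B)"
    unfolding f.inj_on_iff_eq_0[OF fs.subspace_span]
  proof (intro ballI impI)
    fix x assume "x \<in> fs.span B" and fx: "f x = 0"
    from Sf[OF this(1), unfolded fx] show "x = 0" by (rule zero_iff)
  qed
  have "fs.span C \<subseteq> fs.span (f ` B)"
  proof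
    fix c assume c: "c \<in> fs.span C"
    then have cV: "c \<in> V'" using spC by blast
    \<comment> \<open>A preimage \<open>v\<close> of \<open>c\<close> under \<open>R\<close> is
      reduced modulo \<open>U\<close> to \<open>x\<close> in \<open>span B\<close>. Since
      \<open>v - x\<close> is in \<open>U\<close>, its partner \<open>c - w\<close> is in
      \<open>U'\<close>; hence \<open>c - f x\<close> lies in both \<open>span C\<close> and
      \<open>U'\<close> and is zero.\<close>
    from RV'[OF this] obtain v where v: "v \<in> V" "R v c" by blast
    then obtain x where x: "x \<in> fs.span B" "v - x \<in> U" using Bp by blast
    obtain w where w: "R x w" "w - f x \<in> U'" and fx: "f x \<in> fs.span C"
      using Sf[OF x(1)] unfolding S_def by blast
    have wV: "w \<in> V'"
      using fs.subspace_add[OF V'(1), of "w - f x" "f x"] subsetD[OF V'(2) w(2)] subsetD[OF spC fx]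
      unfolding diff_add_cancel by blast
    have "R (v - x) (c - w)"
      using Radd[OF v(2) Rscale[OF w(1), of "-1"]]
      unfolding fscale_minus_one add_uminus_conv_diff .
    moreover have "v - x \<in> V"
      by (rule fs.subspace_diff[OF V]) (use v x spB in auto)
    moreover have "c - w \<in> V'"
      by (rule fs.subspace_diff[OF V'(1) cV wV])
    ultimately have "c - w \<in> U'"
      using RU[of "v - x" "c - w"] x(2) by iprover
    then have "(c - w) + (w - f x) \<in> U'" by (rule fs.subspace_add[OF U' _ w(2)])
    then have "c - f x \<in> fs.span C \<inter> U'"
      using fs.span_diff[OF c fx] by (simp only: diff_add_cancel add_diff_eq Int_iff)
    then have "c - f x = 0" using Cp by blast
    then have "c = f x" by (simp only: right_minus_eq)
    then show "c \<in> fs.span (f ` B)" using x(1) unfolding f.span_image by (rule image_eqI)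
  qed
  moreover have "fs.span (f ` B) \<subseteq> fs.span C"
  proof
    fix y assume "y \<in> fs.span (f ` B)"
    then obtain x where "x \<in> fs.span B" and y: "y = f x" unfolding f.span_image by (rule imageE)
    from Sf[OF this(1)] show "y \<in> fs.span C" unfolding S_def y by (elim conjE)
  qed
  ultimately have sp: "fs.span (f ` B) = fs.span C" by blast
  have ind: "fs.independent (f ` B)"
    using f.independent_injective_image[OF _ inj] Bp by blast
  \<comment> \<open>The image of \<open>B\<close> under \<open>f\<close> and \<open>C\<close> are
    two bases of one space, hence equinumerous.\<close>
  obtain h where h: "bij_betw h (f ` B) C"
    using fs.bij_if_span_eq_span_bases[OF ind _ sp] Cp by blast
  have "bij_betw f B (f ` B)"
    by (rule inj_on_imp_bij_betw[OF inj_on_subset[OF inj fs.span_superset]])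
  from bij_betw_trans[OF this h] show ?thesis
    by (rule exI[of _ "h \<circ> f"])
qed

section \<open>Dimension of a quotient: invariance and additivity\<close>

lemma qbasis_some:
  assumes "fs.subspace U" "fs.subspace V" "U \<subseteq> V"
  shows "qbasis V U (SOME B. qbasis V U B)"
  by (rule qbasis_exists[OF assms], rule someI)

lemma qdim_ordIso_linear_relation:
  fixes R :: "('a \<Rightarrow> real) \<Rightarrow> ('b \<Rightarrow> real) \<Rightarrow> bool"
  assumes "fs.subspace U" "fs.subspace V" "U \<subseteq> V"
    and "fs.subspace U'" "fs.subspace V'" "U' \<subseteq> V'"
    and "R 0 0"
    and "\<And>x y x' y'. R x x' \<Longrightarrow> R y y' \<Longrightarrow> R (x + y) (x' + y')"
    and "\<And>c x x'. R x x' \<Longrightarrow> R (fscale c x) (fscale c x')"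
    and "\<And>x. x \<in> V \<Longrightarrow> \<exists>x'\<in>V'. R x x'"
    and "\<And>x'. x' \<in> V' \<Longrightarrow> \<exists>x\<in>V. R x x'"
    and "\<And>x x'. R x x' \<Longrightarrow> x \<in> V \<Longrightarrow> x' \<in> V' \<Longrightarrow> x \<in> U \<longleftrightarrow> x' \<in> U'"
  shows "(qdim V U, qdim V' U') \<in> ordIso"
  unfolding qdim_def
  unfolding card_of_ordIso[symmetric]
  by (rule qbasis_bij_betw[where R = R, OF assms(1,2,4-12)
        qbasis_some[OF assms(1-3)] qbasis_some[OF assms(4-6)]])

text \<open>Makes the choice in \<open>qdim\<close> harmless: the relation \<open>=\<close> compares
  the chosen basis with \<open>B\<close>.\<close>

lemma qdim_ordIso_card_of:
  assumes U: "fs.subspace U" and V: "fs.subspace V" "U \<subseteq> V" and B: "qbasis V U B"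
  shows "(qdim V U, card_of B) \<in> ordIso"
  unfolding qdim_def card_of_ordIso[symmetric]
  by (rule qbasis_bij_betw[where R = "(=)", OF U V(1) U V _ _ _ _ _ _ qbasis_some[OF U V] B]) auto

text \<open>Corresponds to the exact sequence from \<open>K / U\<close> through \<open>V / U\<close>
  to \<open>V / K\<close>: a basis of \<open>V\<close> modulo \<open>K\<close> together with one of
  \<open>K\<close> modulo \<open>U\<close> is a basis of \<open>V\<close> modulo
  \<open>U\<close>.\<close>

lemma qdim_add:
  assumes U: "fs.subspace U" and K: "fs.subspace K" and V: "fs.subspace V"
    and UK: "U \<subseteq> K" and KV: "K \<subseteq> V"
  shows "(qdim V U, BNF_Cardinal_Arithmetic.csum (qdim V K) (qdim K U)) \<in> ordIso"
proof -
  obtain B where B: "qbasis V K B" using qbasis_exists[OF K V KV] .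
  obtain C where C: "qbasis K U C" using qbasis_exists[OF U K UK] .
  note Bp = B[unfolded qbasis_iff[OF K]] and Cp = C[unfolded qbasis_iff[OF U]]
  have spC: "fs.span C \<subseteq> K" using Cp K by (simp add: fs.span_minimal)
  have ind: "fs.independent (B \<union> C)"
    using independent_Un Bp Cp spC by blast
  \<comment> \<open>A common vector lies in \<open>span B\<close> and in \<open>K\<close>, so it is
    zero, which an independent set cannot contain. Disjointness makes the cardinals add up.\<close>
  have disj: "B \<inter> C = {}"
  proof -
    have "x = 0" if "x \<in> B \<inter> C" for x
      using that Bp Cp by (meson IntD1 IntD2 IntI fs.span_base singletonD subset_eq)
    then show ?thesis using Bp fs.dependent_zero by blast
  qed
  have "qbasis V U (B \<union> C)"
    unfolding qbasis_iff[OF U]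
  proof (intro conjI ballI)
    show "B \<union> C \<subseteq> V" using Bp Cp KV by auto
    show "fs.independent (B \<union> C)" by (rule ind)
    show "fs.span (B \<union> C) \<inter> U \<subseteq> {0}"
    proof
      fix z assume z: "z \<in> fs.span (B \<union> C) \<inter> U"
      then obtain x y where xy: "z = x + y" "x \<in> fs.span B" "y \<in> fs.span C"
        unfolding fs.span_Un by auto
      have "z - y \<in> K" using z UK spC xy K fs.subspace_diff by blast
      then have "x \<in> K" using xy(1) by simp
      then have "x = 0" using xy Bp by blast
      then show "z \<in> {0}" using xy z Cp by auto
    qed
    fix v assume "v \<in> V"
    then obtain x where x: "x \<in> fs.span B" "v - x \<in> K" using Bp by blast
    then obtain y where y: "y \<in> fs.span C" "v - x - y \<in> U" using Cp by blast
    have "x + y \<in> fs.span (B \<union> C)" using x y unfolding fs.span_Un by blast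
    moreover have "v - (x + y) \<in> U" using y by (simp add: diff_diff_eq)
    ultimately show "\<exists>z\<in>fs.span (B \<union> C). v - z \<in> U" by blast
  qed
  then have 1: "(qdim V U, card_of (B \<union> C)) \<in> ordIso"
    using qdim_ordIso_card_of U V UK KV by blast
  have "bij_betw (\<lambda>x. if x \<in> B then Inl x else Inr x) (B \<union> C) (B <+> C)"
    using disj by (intro bij_betwI[where g = "case_sum id id"]) auto
  then have 2: "(card_of (B \<union> C), card_of (B <+> C)) \<in> ordIso"
    using card_of_ordIso by blast
  have 3: "(card_of (B <+> C), BNF_Cardinal_Arithmetic.csum (card_of B) (card_of C)) \<in> ordIso"
    using Plus_csum by blast
  have 4: "(BNF_Cardinal_Arithmetic.csum (card_of B) (card_of C),
      BNF_Cardinal_Arithmetic.csum (qdim V K) (qdim K U)) \<in> ordIso"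
    by (intro csum_cong ordIso_symmetric[OF qdim_ordIso_card_of] assms B C)
  show ?thesis
    by (rule ordIso_transitive[OF 1 ordIso_transitive[OF 2 ordIso_transitive[OF 3 4]]])
qed

lemma Card_order_qdim: "Card_order (qdim V U)"
  by (simp add: qdim_def card_of_Card_order)

text \<open>\<open>K / U\<close> is a subspace of \<open>V / U\<close>; additivity exhibits its
  dimension as a summand.\<close>

lemma qdim_mono_left:
  assumes "fs.subspace U" "fs.subspace K" "fs.subspace V" "U \<subseteq> K" "K \<subseteq> V"
  shows "(qdim K U, qdim V U) \<in> ordLeq"
  by (rule ordLeq_ordIso_trans[OF ordLeq_csum2[OF Card_order_qdim]
        ordIso_symmetric[OF qdim_add[OF assms]]])

text \<open>\<open>V / K\<close> is a quotient of \<open>V / U\<close>, so its dimension is the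
  other summand.\<close>

lemma qdim_antimono_right:
  assumes "fs.subspace U" "fs.subspace K" "fs.subspace V" "U \<subseteq> K" "K \<subseteq> V"
  shows "(qdim V K, qdim V U) \<in> ordLeq"
  by (rule ordLeq_ordIso_trans[OF ordLeq_csum1[OF Card_order_qdim]
        ordIso_symmetric[OF qdim_add[OF assms]]])

section \<open>Cochains in low degrees\<close>

lemma length_2E:
  assumes "length xs = 2"
  obtains x y where "xs = [x, y]"
  using assms that by (auto simp: numeral_2_eq_2 length_Suc_conv)

lemma length_3E:
  assumes "length xs = 3"
  obtains x y z where "xs = [x, y, z]"
  using assms that by (auto simp: numeral_3_eq_3 length_Suc_conv)

lemma cobd_1:
  assumes "x \<in> carrier H" "y \<in> carrier H"
  shows "cobd H 1 \<phi> [x, y] = \<phi> [y] - \<phi> [x \<otimes>\<^bsub>H\<^esub> y] + \<phi> [x]"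
  using assms by (simp add: cobd_def merge_at_def)

lemma cobd_2:
  assumes "x \<in> carrier H" "y \<in> carrier H" "z \<in> carrier H"
  shows "cobd H 2 \<phi> [x, y, z] =
    \<phi> [y, z] - \<phi> [x \<otimes>\<^bsub>H\<^esub> y, z] + \<phi> [x, y \<otimes>\<^bsub>H\<^esub> z] - \<phi> [x, y]"
proof -
  have "{1..2::nat} = {1, 2}" by auto
  then show ?thesis
    using assms by (simp add: cobd_def merge_at_def numeral_2_eq_2)
qed

lemma cobd_3:
  assumes "x \<in> carrier H" "y \<in> carrier H" "z \<in> carrier H" "w \<in> carrier H"
  shows "cobd H 3 \<phi> [x, y, z, w] =
    \<phi> [y, z, w] - \<phi> [x \<otimes>\<^bsub>H\<^esub> y, z, w] + \<phi> [x, y \<otimes>\<^bsub>H\<^esub> z, w]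
      - \<phi> [x, y, z \<otimes>\<^bsub>H\<^esub> w] + \<phi> [x, y, z]"
proof -
  have "{1..3::nat} = {1, 2, 3}" by auto
  then show ?thesis
    using assms by (simp add: cobd_def merge_at_def numeral_2_eq_2 numeral_3_eq_3)
qed

lemma cobd_add: "cobd H n (\<phi> + \<psi>) = cobd H n \<phi> + cobd H n \<psi>"
  by (rule ext) (simp add: cobd_def algebra_simps sum.distrib)

lemma cobd_fscale: "cobd H n (fscale c \<phi>) = fscale c (cobd H n \<phi>)"
  by (rule ext) (simp add: cobd_def fscale_def algebra_simps sum_distrib_left)

lemma cobd_0: "cobd H n 0 = 0"
  using cobd_fscale[of H n 0 0] by (simp only: fs.scale_zero_left)

lemma cobd_minus: "cobd H n (- \<phi>) = - cobd H n \<phi>"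
  using cobd_fscale[of H n "-1" \<phi>] by (simp only: fscale_minus_one)

lemma cobd_diff: "cobd H n (\<phi> - \<psi>) = cobd H n \<phi> - cobd H n \<psi>"
  using cobd_add[of H n \<phi> "- \<psi>"] by (simp only: cobd_minus add_uminus_conv_diff)

lemma cochains_iff: "\<phi> \<in> cochains H n \<longleftrightarrow> (\<forall>xs. \<not> (length xs = n \<and> set xs \<subseteq> carrier H) \<longrightarrow> \<phi> xs = 0)"
  by (auto simp: cochains_def)

lemma cobd_in_cochains: "cobd H n \<phi> \<in> cochains H (Suc n)"
  by (auto simp: cobd_def cochains_def split: if_splits)

lemma pullback_add: "pullback f H n (\<phi> + \<psi>) = pullback f H n \<phi> + pullback f H n \<psi>"
  by (rule ext) (simp add: pullback_def)

lemma pullback_fscale: "pullback f H n (fscale c \<phi>) = fscale c (pullback f H n \<phi>)"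
  by (rule ext) (simp add: pullback_def fscale_def)

lemma pullback_diff: "pullback f H n (\<phi> - \<psi>) = pullback f H n \<phi> - pullback f H n \<psi>"
  by (rule ext) (simp add: pullback_def)

lemma pullback_in_cochains: "pullback f H n \<phi> \<in> cochains H n"
  by (auto simp: pullback_def cochains_def split: if_splits)

section \<open>Testing equality and boundedness on tuples\<close>

lemma cochains_eqI:
  assumes "\<phi> \<in> cochains H n" "\<psi> \<in> cochains H n"
    and "\<And>xs. length xs = n \<Longrightarrow> set xs \<subseteq> carrier H \<Longrightarrow> \<phi> xs = \<psi> xs"
  shows "\<phi> = \<psi>"
proof
  fix xs show "\<phi> xs = \<psi> xs"
  proof (cases "length xs = n \<and> set xs \<subseteq> carrier H")
    case False
    then show ?thesis using assms(1,2) unfolding cochains_iff by metis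
  qed (simp add: assms(3))
qed

lemma cochains_2_eqI:
  assumes "\<phi> \<in> cochains H 2" "\<psi> \<in> cochains H 2"
    and "\<And>x y. x \<in> carrier H \<Longrightarrow> y \<in> carrier H \<Longrightarrow> \<phi> [x, y] = \<psi> [x, y]"
  shows "\<phi> = \<psi>"
  using assms(1,2) by (rule cochains_eqI) (erule length_2E, simp add: assms(3))

lemma cochains_3_eqI:
  assumes "\<phi> \<in> cochains H 3" "\<psi> \<in> cochains H 3"
    and "\<And>x y z. x \<in> carrier H \<Longrightarrow> y \<in> carrier H \<Longrightarrow> z \<in> carrier H \<Longrightarrow> \<phi> [x, y, z] = \<psi> [x, y, z]"
  shows "\<phi> = \<psi>"
  using assms(1,2) by (rule cochains_eqI) (erule length_3E, simp add: assms(3))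

lemma bcochainsI:
  assumes "\<phi> \<in> cochains H n"
    and "\<And>xs. length xs = n \<Longrightarrow> set xs \<subseteq> carrier H \<Longrightarrow> \<bar>\<phi> xs\<bar> \<le> M"
  shows "\<phi> \<in> bcochains H n"
proof -
  \<comment> \<open>Boundedness is demanded on all lists, and \<open>\<phi>\<close> is zero off the
    admissible tuples; the maximum covers the case that \<open>M\<close> is negative.\<close>
  have "\<bar>\<phi> xs\<bar> \<le> max M 0" for xs
  proof (cases "length xs = n \<and> set xs \<subseteq> carrier H")
    case True
    then show ?thesis using assms(2)[of xs] by linarith
  next
    case False
    then have "\<phi> xs = 0" using assms(1) by (auto simp: cochains_def)
    then show ?thesis by simp
  qed
  then show ?thesis
    using assms(1) by (auto simp: bcochains_def bdd_fun_def)
qed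

lemma bcochains_2I:
  assumes "\<phi> \<in> cochains H 2"
    and "\<And>x y. x \<in> carrier H \<Longrightarrow> y \<in> carrier H \<Longrightarrow> \<bar>\<phi> [x, y]\<bar> \<le> M"
  shows "\<phi> \<in> bcochains H 2"
  using assms(1) by (rule bcochainsI[where M = M]) (erule length_2E, simp add: assms(2))

lemma bcochains_3I:
  assumes "\<phi> \<in> cochains H 3"
    and "\<And>x y z. x \<in> carrier H \<Longrightarrow> y \<in> carrier H \<Longrightarrow> z \<in> carrier H \<Longrightarrow> \<bar>\<phi> [x, y, z]\<bar> \<le> M"
  shows "\<phi> \<in> bcochains H 3"
  using assms(1) by (rule bcochainsI[where M = M]) (erule length_3E, simp add: assms(2))

lemma bcochainsE:
  assumes "\<phi> \<in> bcochains H n"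
  obtains M where "\<forall>xs. \<bar>\<phi> xs\<bar> \<le> M"
proof -
  have "\<exists>M. \<forall>xs. \<bar>\<phi> xs\<bar> \<le> M"
    using assms by (simp add: bcochains_def bdd_fun_def)
  then show ?thesis by (elim exE) (rule that)
qed

section \<open>Subspaces of cocycles and coboundaries\<close>

lemma subspace_cochains: "fs.subspace (cochains H n)"
  by (intro fs.subspaceI) (simp_all add: cochains_iff fscale_def)

lemma subspace_bcochains: "fs.subspace (bcochains H n)"
proof (rule fs.subspaceI)
  show "0 \<in> bcochains H n"
    by (rule bcochainsI[of _ _ _ 0]) (auto simp: cochains_def)
next
  fix \<phi> \<psi> assume a: "\<phi> \<in> bcochains H n" "\<psi> \<in> bcochains H n"
  obtain M where M: "\<forall>xs. \<bar>\<phi> xs\<bar> \<le> M" using bcochainsE[OF a(1)] .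
  obtain M' where M': "\<forall>xs. \<bar>\<psi> xs\<bar> \<le> M'" using bcochainsE[OF a(2)] .
  show "\<phi> + \<psi> \<in> bcochains H n"
  proof (rule bcochainsI)
    show "\<phi> + \<psi> \<in> cochains H n"
      using a fs.subspace_add[OF subspace_cochains] by (auto simp: bcochains_def)
    show "\<bar>(\<phi> + \<psi>) xs\<bar> \<le> M + M'" for xs
      using spec[OF M, of xs] spec[OF M', of xs] by simp
  qed
next
  fix c \<phi> assume a: "\<phi> \<in> bcochains H n"
  obtain M where M: "\<forall>xs. \<bar>\<phi> xs\<bar> \<le> M" using bcochainsE[OF a] .
  show "fscale c \<phi> \<in> bcochains H n"
  proof (rule bcochainsI)
    show "fscale c \<phi> \<in> cochains H n"
      using a fs.subspace_scale[OF subspace_cochains] by (auto simp: bcochains_def)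
    show "\<bar>fscale c \<phi> xs\<bar> \<le> \<bar>c\<bar> * M" for xs
      using spec[OF M, of xs] by (simp add: fscale_def abs_mult mult_left_mono)
  qed
qed

lemma subspace_linear_image:
  assumes "fs.subspace S" "\<And>x y. f (x + y) = f x + f y" "\<And>c x. f (fscale c x) = fscale c (f x)"
  shows "fs.subspace (f ` S)"
proof (rule fs.subspaceI)
  have "f 0 = 0" using assms(3)[of 0 0] by (simp only: fs.scale_zero_left)
  then show "0 \<in> f ` S" using fs.subspace_0[OF assms(1)] by (metis imageI)
next
  fix x y assume "x \<in> f ` S" "y \<in> f ` S"
  then show "x + y \<in> f ` S"
    by (elim imageE) (simp only: assms(2)[symmetric] imageI fs.subspace_add[OF assms(1)])
next
  fix c x assume "x \<in> f ` S"
  then show "fscale c x \<in> f ` S"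
    by (elim imageE) (simp only: assms(3)[symmetric] imageI fs.subspace_scale[OF assms(1)])
qed

lemma subspace_single_fzero: "fs.subspace {fzero}"
  unfolding fzero_eq_zero by (rule fs.subspace_single_0)

lemma subspace_coboundaries: "fs.subspace (coboundaries H n)"
  unfolding coboundaries_def
  by (cases "n = 0")
    (simp_all only: refl if_True if_False subspace_single_fzero
      subspace_linear_image[OF subspace_cochains cobd_add cobd_fscale])

lemma subspace_bcoboundaries: "fs.subspace (bcoboundaries H n)"
  unfolding bcoboundaries_def
  by (cases "n = 0")
    (simp_all only: refl if_True if_False subspace_single_fzero
      subspace_linear_image[OF subspace_bcochains cobd_add cobd_fscale])

lemma subspace_cobd_kernel:
  assumes "fs.subspace S"
  shows "fs.subspace {\<phi> \<in> S. cobd H n \<phi> = fzero}"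
  unfolding fzero_eq_zero
proof (rule fs.subspaceI)
  show "0 \<in> {\<phi> \<in> S. cobd H n \<phi> = 0}"
    using fs.subspace_0[OF assms] cobd_0 by blast
next
  fix x y assume "x \<in> {\<phi> \<in> S. cobd H n \<phi> = 0}" "y \<in> {\<phi> \<in> S. cobd H n \<phi> = 0}"
  then show "x + y \<in> {\<phi> \<in> S. cobd H n \<phi> = 0}"
    using fs.subspace_add[OF assms] by (simp only: mem_Collect_eq cobd_add add_0)
next
  fix c x assume "x \<in> {\<phi> \<in> S. cobd H n \<phi> = 0}"
  then show "fscale c x \<in> {\<phi> \<in> S. cobd H n \<phi> = 0}"
    using fs.subspace_scale[OF assms] by (simp only: mem_Collect_eq cobd_fscale fs.scale_zero_right)
qed

lemma subspace_cocycles: "fs.subspace (cocycles H n)"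
  unfolding cocycles_def by (rule subspace_cobd_kernel[OF subspace_cochains])

lemma subspace_bcocycles: "fs.subspace (bcocycles H n)"
  unfolding bcocycles_def by (rule subspace_cobd_kernel[OF subspace_bcochains])

lemma bcocycles_subset: "bcocycles H n \<subseteq> cocycles H n"
  by (simp add: bcocycles_def bcochains_def cocycles_def subset_eq)

section \<open>Cocycle identities in degrees two and three, and pullbacks\<close>

lemma coboundaries_2I: "\<phi> \<in> cochains H 1 \<Longrightarrow> cobd H 1 \<phi> \<in> coboundaries H 2"
  by (simp add: coboundaries_def)

lemma coboundaries_2E:
  assumes "x \<in> coboundaries H 2"
  obtains \<phi> where "\<phi> \<in> cochains H 1" "x = cobd H 1 \<phi>"
proof -
  have "x \<in> cobd H 1 ` cochains H 1"
    using assms by (simp add: coboundaries_def)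
  then show ?thesis by (rule imageE) (rule that)
qed

lemma cocycles_2_iff:
  "\<phi> \<in> cocycles H 2 \<longleftrightarrow> \<phi> \<in> cochains H 2 \<and>
    (\<forall>x\<in>carrier H. \<forall>y\<in>carrier H. \<forall>z\<in>carrier H.
      \<phi> [y, z] - \<phi> [x \<otimes>\<^bsub>H\<^esub> y, z] + \<phi> [x, y \<otimes>\<^bsub>H\<^esub> z] - \<phi> [x, y] = 0)"
proof -
  have "cobd H 2 \<phi> = 0 \<longleftrightarrow> (\<forall>x\<in>carrier H. \<forall>y\<in>carrier H. \<forall>z\<in>carrier H. cobd H 2 \<phi> [x, y, z] = 0)"
  proof
    assume "\<forall>x\<in>carrier H. \<forall>y\<in>carrier H. \<forall>z\<in>carrier H. cobd H 2 \<phi> [x, y, z] = 0"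
    moreover have "cobd H 2 \<phi> \<in> cochains H 3" using cobd_in_cochains[of H 2 \<phi>] by simp
    ultimately show "cobd H 2 \<phi> = 0"
      using fs.subspace_0[OF subspace_cochains[of H 3]] by (intro cochains_3_eqI) auto
  qed simp
  then show ?thesis
    unfolding cocycles_def fzero_eq_zero by (simp add: cobd_2)
qed

lemma (in group) coboundaries_2_subset: "coboundaries G 2 \<subseteq> cocycles G 2"
proof
  fix x assume "x \<in> coboundaries G 2"
  then obtain \<phi> where "x = cobd G 1 \<phi>" by (rule coboundaries_2E)
  then have x: "x = cobd G 1 \<phi>" .
  have "x \<in> cochains G 2"
    using cobd_in_cochains[of G 1 \<phi>] x by (simp add: numeral_2_eq_2)
  moreover have "x [b, c] - x [a \<otimes> b, c] + x [a, b \<otimes> c] - x [a, b] = 0"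
    if "a \<in> carrier G" "b \<in> carrier G" "c \<in> carrier G" for a b c
    using that unfolding x by (simp only: cobd_1 m_closed m_assoc)
  ultimately show "x \<in> cocycles G 2"
    unfolding cocycles_2_iff by blast
qed

lemma (in group) cobd_cobd_2: "cobd G 3 (cobd G 2 \<phi>) = 0"
proof (rule cochains_eqI[of _ G 4])
  show "cobd G 3 (cobd G 2 \<phi>) \<in> cochains G 4"
    using cobd_in_cochains[of G 3] by simp
  show "0 \<in> cochains G 4" by (rule fs.subspace_0[OF subspace_cochains])
  fix xs :: "'a list" assume "length xs = 4" and c: "set xs \<subseteq> carrier G"
  then obtain x y z w where "xs = [x, y, z, w]"
    by (auto simp: numeral_eq_Suc length_Suc_conv)
  then show "cobd G 3 (cobd G 2 \<phi>) xs = 0 xs"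
    using c by (simp add: cobd_3 cobd_2 m_assoc)
qed

lemma bcoboundaries_3_iff: "x \<in> bcoboundaries H 3 \<longleftrightarrow> (\<exists>b\<in>bcochains H 2. x = cobd H 2 b)"
  by (simp add: bcoboundaries_def image_iff)

lemma coboundaries_3_iff: "x \<in> coboundaries H 3 \<longleftrightarrow> (\<exists>b\<in>cochains H 2. x = cobd H 2 b)"
  by (simp add: coboundaries_def image_iff)

lemma cobd_2_bcochains:
  assumes "monoid H" and b: "b \<in> bcochains H 2"
  shows "cobd H 2 b \<in> bcochains H 3"
proof -
  obtain M where M: "\<forall>xs. \<bar>b xs\<bar> \<le> M" using bcochainsE[OF b] .
  show ?thesis
  proof (rule bcochains_3I)
    show "cobd H 2 b \<in> cochains H 3" using cobd_in_cochains[of H 2 b] by simp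
    fix x y z assume c: "x \<in> carrier H" "y \<in> carrier H" "z \<in> carrier H"
    show "\<bar>cobd H 2 b [x, y, z]\<bar> \<le> 4 * M"
      unfolding cobd_2[OF c] using spec[OF M, of "[y, z]"] spec[OF M, of "[x \<otimes>\<^bsub>H\<^esub> y, z]"]
        spec[OF M, of "[x, y \<otimes>\<^bsub>H\<^esub> z]"] spec[OF M, of "[x, y]"]
      by linarith
  qed
qed

lemma (in group) bcoboundaries_3_subset: "bcoboundaries G 3 \<subseteq> bcocycles G 3 \<inter> coboundaries G 3"
proof
  fix x assume "x \<in> bcoboundaries G 3"
  then obtain b where b: "b \<in> bcochains G 2" and x: "x = cobd G 2 b"
    unfolding bcoboundaries_3_iff by blast
  have "x \<in> bcochains G 3" unfolding x by (rule cobd_2_bcochains[OF is_monoid b])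
  moreover have "cobd G 3 x = fzero" unfolding x fzero_eq_zero by (rule cobd_cobd_2)
  moreover have "b \<in> cochains G 2" using b by (simp add: bcochains_def)
  ultimately show "x \<in> bcocycles G 3 \<inter> coboundaries G 3"
    unfolding bcocycles_def Int_iff coboundaries_3_iff x by blast
qed

lemma pullback_2_cocycles:
  assumes "monoid G" "f \<in> hom G H" "c \<in> cocycles H 2"
  shows "pullback f G 2 c \<in> cocycles G 2"
  unfolding cocycles_2_iff
proof (intro conjI ballI)
  show "pullback f G 2 c \<in> cochains G 2" by (rule pullback_in_cochains)
  fix x y z assume c: "x \<in> carrier G" "y \<in> carrier G" "z \<in> carrier G"
  have f: "f x \<in> carrier H" "f y \<in> carrier H" "f z \<in> carrier H"
    using assms(2) c by (simp_all add: hom_in_carrier)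
  have "c [f y, f z] - c [f x \<otimes>\<^bsub>H\<^esub> f y, f z] + c [f x, f y \<otimes>\<^bsub>H\<^esub> f z] - c [f x, f y] = 0"
    using assms(3) f unfolding cocycles_2_iff by blast
  then show "pullback f G 2 c [y, z] - pullback f G 2 c [x \<otimes>\<^bsub>G\<^esub> y, z]
      + pullback f G 2 c [x, y \<otimes>\<^bsub>G\<^esub> z] - pullback f G 2 c [x, y] = 0"
    using c hom_mult[OF assms(2)] monoid.m_closed[OF assms(1)] by (simp add: pullback_def)
qed

lemma pullback_cobd_1:
  assumes "monoid G" "f \<in> hom G H"
  shows "pullback f G 2 (cobd H 1 u) = cobd G 1 (pullback f G 1 u)"
proof (rule cochains_2_eqI[OF pullback_in_cochains])
  show "cobd G 1 (pullback f G 1 u) \<in> cochains G 2"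
    using cobd_in_cochains[of G 1] by (simp add: numeral_2_eq_2)
  fix x y assume c: "x \<in> carrier G" "y \<in> carrier G"
  have "f x \<in> carrier H" "f y \<in> carrier H" "f (x \<otimes>\<^bsub>G\<^esub> y) = f x \<otimes>\<^bsub>H\<^esub> f y" "x \<otimes>\<^bsub>G\<^esub> y \<in> carrier G"
    using assms c by (auto simp: hom_def monoid.m_closed)
  then show "pullback f G 2 (cobd H 1 u) [x, y] = cobd G 1 (pullback f G 1 u) [x, y]"
    unfolding cobd_1[OF c] using c by (simp add: pullback_def cobd_1[unfolded One_nat_def])
qed

text \<open>The cocycle identity at \<open>(x, 1, 1)\<close> and at \<open>(1, 1, x)\<close>. The
  constant \<open>e(1, 1)\<close> is the only trace of the cocycle once one argument comes from the
  kernel of \<open>p\<close>.\<close>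

lemma (in group) cocycle_2_one:
  assumes "e \<in> cocycles G 2" "x \<in> carrier G"
  shows "e [x, \<one>] = e [\<one>, \<one>]" "e [\<one>, x] = e [\<one>, \<one>]"
proof -
  have *: "\<And>x y z. x \<in> carrier G \<Longrightarrow> y \<in> carrier G \<Longrightarrow> z \<in> carrier G \<Longrightarrow>
    e [y, z] - e [x \<otimes> y, z] + e [x, y \<otimes> z] - e [x, y] = 0"
    using assms(1)[unfolded cocycles_2_iff] by blast
  show "e [x, \<one>] = e [\<one>, \<one>]" using *[of x \<one> \<one>] assms(2) by simp
  show "e [\<one>, x] = e [\<one>, \<one>]" using *[of \<one> \<one> x] assms(2) by simp
qed

section \<open>Homogeneous quasimorphisms\<close>

text \<open>The Archimedean property. Applied along the powers of an element, it turns bounded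
  distance between homogeneous functions into equality.\<close>

lemma scaled_bounded_imp_eq:
  fixes a b C :: real
  assumes "\<And>k::nat. \<bar>real k * a - real k * b\<bar> \<le> C"
  shows "a = b"
proof (rule ccontr)
  assume "a \<noteq> b"
  then obtain k :: nat where "C < real k * \<bar>a - b\<bar>"
    using reals_Archimedean3[of "\<bar>a - b\<bar>"] by auto
  moreover have "real k * \<bar>a - b\<bar> = \<bar>real k * a - real k * b\<bar>"
    by (simp add: abs_mult flip: right_diff_distrib)
  ultimately show False using assms[of k] by simp
qed

section \<open>Homogeneous quasimorphisms and invariant functions as vector spaces\<close>

lemma hqm_outside: "f \<in> hqm H \<Longrightarrow> x \<notin> carrier H \<Longrightarrow> f x = 0"
  by (simp add: hqm_def)

lemma hqm_defect:
  assumes "f \<in> hqm H"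
  obtains D where "\<forall>x\<in>carrier H. \<forall>y\<in>carrier H. \<bar>f (x \<otimes>\<^bsub>H\<^esub> y) - f x - f y\<bar> \<le> D"
proof -
  have "\<exists>D. \<forall>x\<in>carrier H. \<forall>y\<in>carrier H. \<bar>f (x \<otimes>\<^bsub>H\<^esub> y) - f x - f y\<bar> \<le> D"
    using assms by (simp add: hqm_def)
  then show ?thesis by (elim exE) (rule that)
qed

lemma hqm_int_pow: "f \<in> hqm H \<Longrightarrow> x \<in> carrier H \<Longrightarrow> f (x [^]\<^bsub>H\<^esub> (k::int)) = of_int k * f x"
  by (simp add: hqm_def)

lemma hqm_nat_pow: "f \<in> hqm H \<Longrightarrow> x \<in> carrier H \<Longrightarrow> f (x [^]\<^bsub>H\<^esub> (k::nat)) = real k * f x"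
  using hqm_int_pow[of f H x "int k"] by (simp add: int_pow_int)

lemma (in group) hqm_one: "f \<in> hqm G \<Longrightarrow> f \<one> = 0"
  using hqm_nat_pow[of f G \<one> 0] by simp

lemma (in group) hqm_inv: "f \<in> hqm G \<Longrightarrow> x \<in> carrier G \<Longrightarrow> f (inv x) = - f x"
  using hqm_int_pow[of f G x "-1"] by (simp add: int_pow_neg)

lemma subspace_hqm: "fs.subspace (hqm H)"
proof (rule fs.subspaceI)
  show "0 \<in> hqm H" by (auto simp: hqm_def)
next
  fix f g assume fg: "f \<in> hqm H" "g \<in> hqm H"
  obtain D where D: "\<forall>x\<in>carrier H. \<forall>y\<in>carrier H. \<bar>f (x \<otimes>\<^bsub>H\<^esub> y) - f x - f y\<bar> \<le> D"
    using fg(1) by (rule hqm_defect)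
  obtain D' where D': "\<forall>x\<in>carrier H. \<forall>y\<in>carrier H. \<bar>g (x \<otimes>\<^bsub>H\<^esub> y) - g x - g y\<bar> \<le> D'"
    using fg(2) by (rule hqm_defect)
  have "\<forall>x\<in>carrier H. \<forall>y\<in>carrier H. \<bar>(f + g) (x \<otimes>\<^bsub>H\<^esub> y) - (f + g) x - (f + g) y\<bar> \<le> D + D'"
  proof (intro ballI)
    fix x y assume "x \<in> carrier H" "y \<in> carrier H"
    with D D' have "\<bar>f (x \<otimes>\<^bsub>H\<^esub> y) - f x - f y\<bar> \<le> D" "\<bar>g (x \<otimes>\<^bsub>H\<^esub> y) - g x - g y\<bar> \<le> D'"
      by simp_all
    then show "\<bar>(f + g) (x \<otimes>\<^bsub>H\<^esub> y) - (f + g) x - (f + g) y\<bar> \<le> D + D'" by simp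
  qed
  moreover have "\<forall>x\<in>carrier H. \<forall>k::int. (f + g) (x [^]\<^bsub>H\<^esub> k) = of_int k * (f + g) x"
    using fg by (simp add: hqm_int_pow distrib_left)
  moreover have "\<forall>x. x \<notin> carrier H \<longrightarrow> (f + g) x = 0"
    using fg by (simp add: hqm_outside)
  ultimately show "f + g \<in> hqm H"
    unfolding hqm_def mem_Collect_eq by (intro conjI exI[of _ "D + D'"])
next
  fix c f assume f: "f \<in> hqm H"
  obtain D where D: "\<forall>x\<in>carrier H. \<forall>y\<in>carrier H. \<bar>f (x \<otimes>\<^bsub>H\<^esub> y) - f x - f y\<bar> \<le> D"
    using f by (rule hqm_defect)
  have "\<forall>x\<in>carrier H. \<forall>y\<in>carrier H.
      \<bar>fscale c f (x \<otimes>\<^bsub>H\<^esub> y) - fscale c f x - fscale c f y\<bar> \<le> \<bar>c\<bar> * D"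
  proof (intro ballI)
    fix x y assume "x \<in> carrier H" "y \<in> carrier H"
    with D have "\<bar>f (x \<otimes>\<^bsub>H\<^esub> y) - f x - f y\<bar> \<le> D" by simp
    then have "\<bar>c\<bar> * \<bar>f (x \<otimes>\<^bsub>H\<^esub> y) - f x - f y\<bar> \<le> \<bar>c\<bar> * D" by (simp add: mult_left_mono)
    then show "\<bar>fscale c f (x \<otimes>\<^bsub>H\<^esub> y) - fscale c f x - fscale c f y\<bar> \<le> \<bar>c\<bar> * D"
      by (simp add: fscale_def abs_mult[symmetric] right_diff_distrib)
  qed
  moreover have "\<forall>x\<in>carrier H. \<forall>k::int. fscale c f (x [^]\<^bsub>H\<^esub> k) = of_int k * fscale c f x"
    using f by (simp add: hqm_int_pow fscale_def)
  moreover have "\<forall>x. x \<notin> carrier H \<longrightarrow> fscale c f x = 0"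
    using f by (simp add: hqm_outside fscale_def)
  ultimately show "fscale c f \<in> hqm H"
    unfolding hqm_def mem_Collect_eq by (intro conjI exI[of _ "\<bar>c\<bar> * D"])
qed

lemma subspace_homs_R: "fs.subspace (homs_R H)"
  by (intro fs.subspaceI) (simp_all add: homs_R_def fscale_def distrib_left)

lemma subspace_G_invariant:
  assumes "fs.subspace S"
  shows "fs.subspace {f \<in> S. G_invariant N G i f}"
proof (rule fs.subspaceI)
  show "0 \<in> {f \<in> S. G_invariant N G i f}"
    using fs.subspace_0[OF assms] by (simp add: G_invariant_def)
next
  fix f g assume "f \<in> {f \<in> S. G_invariant N G i f}" "g \<in> {f \<in> S. G_invariant N G i f}"
  then show "f + g \<in> {f \<in> S. G_invariant N G i f}"
    using fs.subspace_add[OF assms] by (simp add: G_invariant_def)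
next
  fix c f assume "f \<in> {f \<in> S. G_invariant N G i f}"
  then show "fscale c f \<in> {f \<in> S. G_invariant N G i f}"
    using fs.subspace_scale[OF assms] by (simp add: G_invariant_def) (simp add: fscale_def)
qed

lemma subspace_QNG: "fs.subspace (QNG N G i)"
  unfolding QNG_def by (rule subspace_G_invariant[OF subspace_hqm])

lemma subspace_H1NG: "fs.subspace (H1NG N G i)"
  unfolding H1NG_def by (rule subspace_G_invariant[OF subspace_homs_R])

lemma subspace_restrQG: "fs.subspace (restrQG N G i)"
  unfolding restrQG_def
  by (rule subspace_linear_image[OF subspace_hqm]) (rule ext, simp add: fscale_def)+

lemma (in group) homs_R_subset_hqm: "homs_R G \<subseteq> hqm G"
proof
  fix h assume h: "h \<in> homs_R G"
  have mult: "h (x \<otimes> y) = h x + h y" if "x \<in> carrier G" "y \<in> carrier G" for x y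
    using h that by (simp add: homs_R_def)
  have one: "h \<one> = 0" using mult[of \<one> \<one>] by simp
  have nat: "h (x [^] (k::nat)) = real k * h x" if "x \<in> carrier G" for x k
    using that by (induction k) (simp_all add: one mult distrib_right)
  have inv: "h (inv x) = - h x" if "x \<in> carrier G" for x
    using mult[of x "inv x"] that by (simp add: one)
  have "h (x [^] (k::int)) = of_int k * h x" if x: "x \<in> carrier G" for x k
  proof (cases k rule: int_cases2)
    case (nonneg n)
    then show ?thesis using x by (simp add: int_pow_int nat)
  next
    case (nonpos n)
    then show ?thesis using x by (simp add: int_pow_neg int_pow_int inv nat)
  qed
  then show "h \<in> hqm G"
    using h mult unfolding hqm_def mem_Collect_eq homs_R_def
    by (intro conjI exI[of _ 0]) simp_all
qed

text \<open>The limit is taken along the powers \<open>x^(2^n)\<close> only, so that consecutive terms differ by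
  \<open>D / 2^(n+1)\<close>.\<close>

lemma (in group) homogenization:
  assumes D: "\<And>x y. x \<in> carrier G \<Longrightarrow> y \<in> carrier G \<Longrightarrow> \<bar>f (x \<otimes> y) - f x - f y\<bar> \<le> D"
  obtains \<psi> where "\<psi> \<in> hqm G" "\<forall>x\<in>carrier G. \<bar>\<psi> x - f x\<bar> \<le> D"
proof -
  define a where "a x n = f (x [^] (2 ^ n :: nat)) / 2 ^ n" for x and n :: nat
  have step: "\<bar>a x (Suc n) - a x n\<bar> \<le> D / 2 * (1 / 2) ^ n" if x: "x \<in> carrier G" for x n
  proof -
    have "x [^] (2 ^ Suc n :: nat) = x [^] (2 ^ n :: nat) \<otimes> x [^] (2 ^ n :: nat)"
      using x by (simp add: nat_pow_mult mult_2)
    then have "a x (Suc n) - a x n =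
        (f (x [^] (2 ^ n :: nat) \<otimes> x [^] (2 ^ n :: nat)) - f (x [^] (2 ^ n :: nat)) - f (x [^] (2 ^ n :: nat)))
          / 2 ^ Suc n"
      by (simp add: a_def field_simps)
    then have "\<bar>a x (Suc n) - a x n\<bar> =
        \<bar>f (x [^] (2 ^ n :: nat) \<otimes> x [^] (2 ^ n :: nat)) - f (x [^] (2 ^ n :: nat)) - f (x [^] (2 ^ n :: nat))\<bar>
          / 2 ^ Suc n"
      by (simp add: abs_divide)
    also have "\<dots> \<le> D / 2 ^ Suc n"
      using x by (intro divide_right_mono D nat_pow_closed) simp_all
    finally show ?thesis by (simp add: power_divide)
  qed
  \<comment> \<open>The errors sum to exactly \<open>D\<close>, and the sequence starts at
    \<open>a x 0 = f x\<close>; hence the limit stays within \<open>D\<close> of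
    \<open>f\<close>.\<close>
  have geo: "(\<lambda>n. D / 2 * (1 / 2) ^ n) sums D"
    using sums_mult[OF geometric_sums[of "1 / 2 :: real"], of "D / 2"] by simp
  define S where "S x = (\<Sum>n. a x (Suc n) - a x n)" for x
  have lim: "a x \<longlonglongrightarrow> a x 0 + S x" and bd: "\<bar>S x\<bar> \<le> D" if x: "x \<in> carrier G" for x
  proof -
    have nrm: "\<And>n. norm (a x (Suc n) - a x n) \<le> D / 2 * (1 / 2) ^ n"
      using step[OF x] by simp
    have sm: "summable (\<lambda>n. a x (Suc n) - a x n)"
      by (rule summable_comparison_test'[OF sums_summable[OF geo] nrm])
    have "norm (S x) \<le> (\<Sum>n. D / 2 * (1 / 2) ^ n)"
      unfolding S_def by (rule norm_suminf_le[OF nrm sums_summable[OF geo]])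
    then show "\<bar>S x\<bar> \<le> D" using sums_unique[OF geo] by simp
    have "(\<lambda>n. \<Sum>k<n. a x (Suc k) - a x k) \<longlonglongrightarrow> S x"
      using sm unfolding S_def by (rule summable_LIMSEQ)
    then have "(\<lambda>n. a x n - a x 0) \<longlonglongrightarrow> S x" by (simp add: sum_lessThan_telescope)
    from tendsto_add[OF tendsto_const[of "a x 0"] this] show "a x \<longlonglongrightarrow> a x 0 + S x" by simp
  qed
  define \<psi> where "\<psi> x = (if x \<in> carrier G then a x 0 + S x else 0)" for x
  have close: "\<bar>\<psi> x - f x\<bar> \<le> D" if "x \<in> carrier G" for x
    using bd that by (simp add: \<psi>_def a_def)
  have limpsi: "a x \<longlonglongrightarrow> \<psi> x" if "x \<in> carrier G" for x
    using lim that by (simp add: \<psi>_def)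
  \<comment> \<open>The constant depends on \<open>k\<close> but not on \<open>y\<close>; uniformity
    matters because \<open>y\<close> will run through the powers \<open>x^(2^n)\<close>.\<close>
  have npow: "\<exists>C. \<forall>y\<in>carrier G. \<bar>f (y [^] (k::nat)) - real k * f y\<bar> \<le> C" for k
  proof (induction k)
    case 0
    show ?case by (intro exI[of _ "\<bar>f \<one>\<bar>"]) simp
  next
    case (Suc k)
    then obtain C where C: "\<forall>y\<in>carrier G. \<bar>f (y [^] k) - real k * f y\<bar> \<le> C" by blast
    have "\<bar>f (y [^] Suc k) - real (Suc k) * f y\<bar> \<le> C + D" if y: "y \<in> carrier G" for y
      using D[of "y [^] k" y] bspec[OF C y] y by (simp add: distrib_right)
    then show ?case by blast
  qed
  have ipow: "\<exists>C. \<forall>y\<in>carrier G. \<bar>f (y [^] (k::int)) - of_int k * f y\<bar> \<le> C" for k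
  proof (cases k rule: int_cases2)
    case (nonneg n)
    then show ?thesis using npow[of n] by (simp add: int_pow_int)
  next
    case (nonpos n)
    obtain C where C: "\<forall>y\<in>carrier G. \<bar>f (y [^] n) - real n * f y\<bar> \<le> C" using npow by blast
    have "\<bar>f (y [^] k) - of_int k * f y\<bar> \<le> C + D + \<bar>f \<one>\<bar>" if y: "y \<in> carrier G" for y
    proof -
      have "\<bar>f \<one> - f (y [^] n) - f (inv (y [^] n))\<bar> \<le> D"
        using D[of "y [^] n" "inv (y [^] n)"] y by simp
      then show ?thesis
        using bspec[OF C y] y unfolding nonpos by (simp add: int_pow_neg int_pow_int)
    qed
    then show ?thesis by blast
  qed
  have hom: "\<psi> (x [^] k) = of_int k * \<psi> x" if x: "x \<in> carrier G" for x and k :: int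
  proof -
    obtain C where C: "\<forall>y\<in>carrier G. \<bar>f (y [^] k) - of_int k * f y\<bar> \<le> C" using ipow by blast
    have "\<bar>a (x [^] k) n - of_int k * a x n\<bar> \<le> C / 2 ^ n" for n
    proof -
      \<comment> \<open>Powers of \<open>x\<close> commute, so the bound for exponent
        \<open>k\<close> applies at \<open>x^(2^n)\<close>; division by \<open>2^n\<close> removes
        it in the limit.\<close>
      have "(x [^] k) [^] (2 ^ n :: nat) = (x [^] (2 ^ n :: nat)) [^] k"
        using x by (simp add: int_pow_pow mult.commute flip: int_pow_int)
      then have "a (x [^] k) n - of_int k * a x n =
          (f ((x [^] (2 ^ n :: nat)) [^] k) - of_int k * f (x [^] (2 ^ n :: nat))) / 2 ^ n"
        by (simp add: a_def diff_divide_distrib)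
      then show ?thesis
        using bspec[OF C nat_pow_closed[OF x]] by (simp add: abs_divide divide_right_mono)
    qed
    then have le: "norm (a (x [^] k) n - of_int k * a x n) \<le> norm (C / 2 ^ n) * 1" for n
      unfolding real_norm_def mult_1_right by (rule order_trans[OF _ abs_ge_self])
    have "(\<lambda>n. C / 2 ^ n) \<longlonglongrightarrow> 0"
      using tendsto_mult[OF tendsto_const[of C] LIMSEQ_power_zero[of "1 / 2 :: real"]]
      by (simp add: power_divide)
    then have lim0: "(\<lambda>n. a (x [^] k) n - of_int k * a x n) \<longlonglongrightarrow> 0"
      by (rule tendsto_0_le[OF _ always_eventually[OF allI[OF le]]])
    have "(\<lambda>n. a (x [^] k) n - of_int k * a x n) \<longlonglongrightarrow> \<psi> (x [^] k) - of_int k * \<psi> x"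
      using x by (intro tendsto_diff tendsto_mult tendsto_const limpsi) auto
    from LIMSEQ_unique[OF this lim0] show ?thesis by simp
  qed
  \<comment> \<open>One \<open>D\<close> for the defect of \<open>f\<close> and one for each of the
    three replacements of \<open>f\<close> by \<open>\<psi>\<close>.\<close>
  have "\<bar>\<psi> (x \<otimes> y) - \<psi> x - \<psi> y\<bar> \<le> 4 * D" if "x \<in> carrier G" "y \<in> carrier G" for x y
    using close[OF that(1)] close[OF that(2)] close[OF m_closed[OF that]] D[OF that] by linarith
  then have "\<psi> \<in> hqm G"
    unfolding hqm_def mem_Collect_eq using hom by (intro conjI exI[of _ "4 * D"]) (simp_all add: \<psi>_def)
  then show ?thesis using close by (intro that) auto
qed

lemma (in group) conj_nat_pow:
  assumes "g \<in> carrier G" "x \<in> carrier G"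
  shows "(g \<otimes> x \<otimes> inv g) [^] (k::nat) = g \<otimes> x [^] k \<otimes> inv g"
proof (induction k)
  case 0
  then show ?case using assms by simp
next
  case (Suc k)
  have "g \<otimes> x [^] k \<otimes> inv g \<otimes> (g \<otimes> x \<otimes> inv g) = g \<otimes> x [^] k \<otimes> (inv g \<otimes> g) \<otimes> x \<otimes> inv g"
    using assms by (simp only: m_assoc m_closed inv_closed nat_pow_closed)
  then show ?case using assms Suc by (simp add: m_assoc)
qed

text \<open>Splitting \<open>g x^k g^-1\<close> into its factors costs \<open>2 * D\<close>, and
  \<open>f g\<close> cancels \<open>f (inv g)\<close>. Thus \<open>k\<close> times the difference of
  the two values stays bounded for all \<open>k\<close>.\<close>

lemma (in group) hqm_conj:
  assumes f: "f \<in> hqm G" and g: "g \<in> carrier G" and x: "x \<in> carrier G"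
  shows "f (g \<otimes> x \<otimes> inv g) = f x"
proof -
  obtain D where D: "\<forall>x\<in>carrier G. \<forall>y\<in>carrier G. \<bar>f (x \<otimes> y) - f x - f y\<bar> \<le> D"
    using f by (rule hqm_defect)
  have "\<bar>real k * f (g \<otimes> x \<otimes> inv g) - real k * f x\<bar> \<le> 2 * D" for k
  proof -
    let ?y = "x [^] k"
    have y: "?y \<in> carrier G" using x by simp
    have "real k * f (g \<otimes> x \<otimes> inv g) = f (g \<otimes> ?y \<otimes> inv g)"
      using hqm_nat_pow[OF f, of "g \<otimes> x \<otimes> inv g" k] g x by (simp add: conj_nat_pow)
    moreover have "real k * f x = f ?y" using hqm_nat_pow[OF f x] by simp
    moreover have "\<bar>f (g \<otimes> ?y \<otimes> inv g) - f (g \<otimes> ?y) - f (inv g)\<bar> \<le> D"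
      using D g y by blast
    moreover have "\<bar>f (g \<otimes> ?y) - f g - f ?y\<bar> \<le> D" using D g y by blast
    ultimately show ?thesis using hqm_inv[OF f g] by linarith
  qed
  then show ?thesis by (rule scaled_bounded_imp_eq)
qed

section \<open>Group extensions\<close>

locale group_extension = N: group N + G: group G + Gm: group Gm
  for N :: "('n, 'x) monoid_scheme" and G :: "('a, 'y) monoid_scheme" and Gm :: "('c, 'z) monoid_scheme" +
  fixes i :: "'n \<Rightarrow> 'a" and p :: "'a \<Rightarrow> 'c" and s :: "'c \<Rightarrow> 'a"
  assumes i_hom: "i \<in> hom N G" and i_inj: "inj_on i (carrier N)"
    and p_hom: "p \<in> hom G Gm" and exact: "i ` carrier N = kernel G Gm p"
    and section_carrier: "\<And>a. a \<in> carrier Gm \<Longrightarrow> s a \<in> carrier G"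
    and p_section: "\<And>a. a \<in> carrier Gm \<Longrightarrow> p (s a) = a"
    and section_one: "s \<one>\<^bsub>Gm\<^esub> = \<one>\<^bsub>G\<^esub>"
begin

sublocale i: group_hom N G i
  by unfold_locales (rule i_hom)

sublocale p: group_hom G Gm p
  by unfold_locales (rule p_hom)

text \<open>Transports a function on \<open>N\<close> along \<open>i\<close> to the kernel of
  \<open>p\<close>, so that calculations take place inside \<open>G\<close>.\<close>

definition on_kernel :: "('n \<Rightarrow> real) \<Rightarrow> 'a \<Rightarrow> real" where
  "on_kernel \<mu> x = \<mu> (the_inv_into (carrier N) i x)"

abbreviation "ker \<equiv> kernel G Gm p"

abbreviation "mus \<equiv> mu_s_cochain N G i p s"

abbreviation "tau \<equiv> tau_rep N G Gm i p s"

abbreviation "dtau \<equiv> dtau_rep N G Gm i p s"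

abbreviation nfactor :: "'a \<Rightarrow> 'a" where
  "nfactor g \<equiv> g \<otimes>\<^bsub>G\<^esub> inv\<^bsub>G\<^esub> s (p g)"

text \<open>The Schreier factor set of the section, which measures how far \<open>s\<close> is from
  a homomorphism.\<close>

abbreviation factor_set :: "'c \<Rightarrow> 'c \<Rightarrow> 'a" where
  "factor_set a b \<equiv> s a \<otimes>\<^bsub>G\<^esub> s b \<otimes>\<^bsub>G\<^esub> inv\<^bsub>G\<^esub> s (a \<otimes>\<^bsub>Gm\<^esub> b)"

section \<open>Calculus on the kernel of \<open>p\<close>\<close>

lemma ker_iff: "x \<in> ker \<longleftrightarrow> x \<in> carrier G \<and> p x = \<one>\<^bsub>Gm\<^esub>"
  by (simp add: kernel_def)

lemma i_in_ker: "n \<in> carrier N \<Longrightarrow> i n \<in> ker"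
  using exact by blast

lemma kerE:
  assumes "x \<in> ker"
  obtains n where "n \<in> carrier N" "x = i n"
  using assms exact by blast

lemma on_kernel_i: "n \<in> carrier N \<Longrightarrow> on_kernel \<mu> (i n) = \<mu> n"
  by (simp add: on_kernel_def the_inv_into_f_f[OF i_inj])

lemma mult_in_ker: "x \<in> ker \<Longrightarrow> y \<in> ker \<Longrightarrow> x \<otimes>\<^bsub>G\<^esub> y \<in> ker"
  by (simp add: ker_iff)

lemma conj_in_ker: "g \<in> carrier G \<Longrightarrow> x \<in> ker \<Longrightarrow> g \<otimes>\<^bsub>G\<^esub> x \<otimes>\<^bsub>G\<^esub> inv\<^bsub>G\<^esub> g \<in> ker"
  by (simp add: ker_iff)

lemma nfactor_in_ker: "g \<in> carrier G \<Longrightarrow> nfactor g \<in> ker"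
  by (simp add: ker_iff section_carrier p_section)

lemma factor_set_in_ker: "a \<in> carrier Gm \<Longrightarrow> b \<in> carrier Gm \<Longrightarrow> factor_set a b \<in> ker"
  by (simp add: ker_iff section_carrier p_section)

lemma on_kernel_one: "on_kernel \<mu> \<one>\<^bsub>G\<^esub> = \<mu> \<one>\<^bsub>N\<^esub>"
  using on_kernel_i[OF N.one_closed] by simp

lemma on_kernel_mult:
  assumes "\<forall>x\<in>carrier N. \<forall>y\<in>carrier N. \<bar>\<mu> (x \<otimes>\<^bsub>N\<^esub> y) - \<mu> x - \<mu> y\<bar> \<le> D" "x \<in> ker" "y \<in> ker"
  shows "\<bar>on_kernel \<mu> (x \<otimes>\<^bsub>G\<^esub> y) - on_kernel \<mu> x - on_kernel \<mu> y\<bar> \<le> D"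
proof -
  obtain n where n: "n \<in> carrier N" "x = i n" using assms(2) by (rule kerE)
  obtain m where m: "m \<in> carrier N" "y = i m" using assms(3) by (rule kerE)
  have "on_kernel \<mu> (x \<otimes>\<^bsub>G\<^esub> y) = \<mu> (n \<otimes>\<^bsub>N\<^esub> m)"
    using n m on_kernel_i[of "n \<otimes>\<^bsub>N\<^esub> m" \<mu>] by simp
  then show ?thesis using assms(1) n m by (simp add: on_kernel_i)
qed

lemma on_kernel_conj:
  assumes "G_invariant N G i \<mu>" "g \<in> carrier G" "x \<in> ker"
  shows "on_kernel \<mu> (g \<otimes>\<^bsub>G\<^esub> x \<otimes>\<^bsub>G\<^esub> inv\<^bsub>G\<^esub> g) = on_kernel \<mu> x"
proof -
  obtain n where n: "n \<in> carrier N" "x = i n" using assms(3) by (rule kerE)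
  obtain m where m: "m \<in> carrier N" "g \<otimes>\<^bsub>G\<^esub> x \<otimes>\<^bsub>G\<^esub> inv\<^bsub>G\<^esub> g = i m"
    using conj_in_ker[OF assms(2,3)] by (rule kerE)
  have "\<mu> m = \<mu> n"
    using assms(1,2) n m unfolding G_invariant_def by metis
  then show ?thesis using n m by (simp add: on_kernel_i)
qed

section \<open>The cochains \<open>mus \<mu>\<close> and \<open>tau \<mu>\<close> and their
  coboundaries\<close>

lemma mus_apply: "g \<in> carrier G \<Longrightarrow> mus \<mu> [g] = on_kernel \<mu> (nfactor g)"
  by (simp add: mu_s_cochain_def mu_s_def on_kernel_def)

lemma mus_in_cochains: "mus \<mu> \<in> cochains G 1"
  by (simp add: cochains_iff mu_s_cochain_def)

text \<open>Since \<open>p (i n) = 1\<close> and the section is normalized by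
  \<open>s 1 = 1\<close>, no correction factor remains.\<close>

lemma mus_i: "n \<in> carrier N \<Longrightarrow> mus \<mu> [i n] = \<mu> n"
  using i_in_ker[of n] by (simp add: mus_apply ker_iff section_one on_kernel_i)

lemma tau_in_cochains: "tau \<mu> \<in> cochains Gm 2"
  unfolding tau_rep_def by (rule pullback_in_cochains)

text \<open>\<open>\<mu>_s\<close> vanishes on the section, where the kernel part is
  \<open>1\<close>; only the middle term of \<open>\<delta>\<close> survives, which accounts for the
  minus sign.\<close>

lemma tau_apply:
  assumes "\<mu> \<one>\<^bsub>N\<^esub> = 0" "a \<in> carrier Gm" "b \<in> carrier Gm"
  shows "tau \<mu> [a, b] = - on_kernel \<mu> (factor_set a b)"
proof -
  have "mus \<mu> [s a] = 0" if "a \<in> carrier Gm" for a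
    using that assms(1) by (simp add: mus_apply section_carrier p_section on_kernel_one)
  then show ?thesis
    using assms(2,3)
    by (simp add: tau_rep_def pullback_def cobd_1[unfolded One_nat_def] mus_apply section_carrier p_section)
qed

text \<open>Writing \<open>g = n s(p g)\<close> and \<open>h = m s(p h)\<close> with \<open>n\<close>, \<open>m\<close> in the kernel, the kernel part of \<open>g h\<close> is
  \<open>n\<close> times a conjugate of \<open>m\<close> times the factor set at \<open>(p g, p h)\<close>.\<close>

lemma nfactor_mult:
  assumes g: "g \<in> carrier G" and h: "h \<in> carrier G"
  shows "nfactor (g \<otimes>\<^bsub>G\<^esub> h) =
    nfactor g \<otimes>\<^bsub>G\<^esub> (s (p g) \<otimes>\<^bsub>G\<^esub> nfactor h \<otimes>\<^bsub>G\<^esub> inv\<^bsub>G\<^esub> s (p g)) \<otimes>\<^bsub>G\<^esub> factor_set (p g) (p h)"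
proof -
  have c: "inv\<^bsub>G\<^esub> x \<otimes>\<^bsub>G\<^esub> (x \<otimes>\<^bsub>G\<^esub> y) = y" if "x \<in> carrier G" "y \<in> carrier G" for x y
    using that by (simp flip: G.m_assoc)
  show ?thesis
    using g h by (simp add: section_carrier G.m_assoc c)
qed

text \<open>In the three-factor formula for the kernel part of \<open>g h\<close>, two applications
  of the defect bound cost \<open>2 * D\<close>, invariance removes the conjugation, and the first
  two factors cancel against \<open>\<mu>_s(g)\<close> and \<open>\<mu>_s(h)\<close>. For
  \<open>D = 0\<close> this is an equality.\<close>

lemma cobd_mus_approx:
  assumes D: "\<forall>x\<in>carrier N. \<forall>y\<in>carrier N. \<bar>\<mu> (x \<otimes>\<^bsub>N\<^esub> y) - \<mu> x - \<mu> y\<bar> \<le> D"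
    and inv: "G_invariant N G i \<mu>" and one: "\<mu> \<one>\<^bsub>N\<^esub> = 0"
    and g: "g \<in> carrier G" and h: "h \<in> carrier G"
  shows "\<bar>cobd G 1 (mus \<mu>) [g, h] - tau \<mu> [p g, p h]\<bar> \<le> 2 * D"
proof -
  let ?n = "nfactor g" and ?m = "s (p g) \<otimes>\<^bsub>G\<^esub> nfactor h \<otimes>\<^bsub>G\<^esub> inv\<^bsub>G\<^esub> s (p g)"
    and ?w = "factor_set (p g) (p h)"
  have k: "?n \<in> ker" "?m \<in> ker" "?w \<in> ker"
    using g h by (auto intro!: nfactor_in_ker conj_in_ker factor_set_in_ker section_carrier)
  have "\<bar>on_kernel \<mu> (?n \<otimes>\<^bsub>G\<^esub> ?m \<otimes>\<^bsub>G\<^esub> ?w) - on_kernel \<mu> (?n \<otimes>\<^bsub>G\<^esub> ?m) - on_kernel \<mu> ?w\<bar> \<le> D"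
    by (rule on_kernel_mult[of \<mu>, OF D mult_in_ker[OF k(1,2)] k(3)])
  moreover have "\<bar>on_kernel \<mu> (?n \<otimes>\<^bsub>G\<^esub> ?m) - on_kernel \<mu> ?n - on_kernel \<mu> ?m\<bar> \<le> D"
    by (rule on_kernel_mult[of \<mu>, OF D k(1,2)])
  moreover have "on_kernel \<mu> ?m = on_kernel \<mu> (nfactor h)"
    by (rule on_kernel_conj[of \<mu>, OF inv section_carrier nfactor_in_ker[OF h]]) (use g in simp)
  moreover have "tau \<mu> [p g, p h] = - on_kernel \<mu> ?w"
    by (rule tau_apply[of \<mu>, OF one]) (use g h in simp_all)
  moreover have "mus \<mu> [g \<otimes>\<^bsub>G\<^esub> h] = on_kernel \<mu> (?n \<otimes>\<^bsub>G\<^esub> ?m \<otimes>\<^bsub>G\<^esub> ?w)"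
    unfolding mus_apply[OF G.m_closed[OF g h]] nfactor_mult[OF g h] ..
  ultimately show ?thesis
    unfolding cobd_1[OF g h] mus_apply[OF g] mus_apply[OF h] by linarith
qed

text \<open>Compares \<open>\<delta>\<tau>(\<mu>)\<close> with the vanishing
  \<open>\<delta>\<delta>\<mu>_s\<close> at \<open>(s a, s b, s c)\<close>. Although
  \<open>s a s b\<close> may differ from \<open>s(a b)\<close>, both lie over \<open>a b\<close>, so
  each of the four terms is off by at most \<open>2 * D\<close>.\<close>

lemma dtau_approx:
  assumes D: "\<forall>x\<in>carrier N. \<forall>y\<in>carrier N. \<bar>\<mu> (x \<otimes>\<^bsub>N\<^esub> y) - \<mu> x - \<mu> y\<bar> \<le> D"
    and inv: "G_invariant N G i \<mu>" and one: "\<mu> \<one>\<^bsub>N\<^esub> = 0"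
    and a: "a \<in> carrier Gm" and b: "b \<in> carrier Gm" and c: "c \<in> carrier Gm"
  shows "\<bar>dtau \<mu> [a, b, c]\<bar> \<le> 8 * D"
proof -
  let ?d = "cobd G 1 (mus \<mu>)"
  let ?a = "s a" and ?b = "s b" and ?c = "s c"
  have car: "?a \<in> carrier G" "?b \<in> carrier G" "?c \<in> carrier G"
    using a b c section_carrier by simp_all
  have coc: "?d [?b, ?c] - ?d [?a \<otimes>\<^bsub>G\<^esub> ?b, ?c] + ?d [?a, ?b \<otimes>\<^bsub>G\<^esub> ?c] - ?d [?a, ?b] = 0"
  proof -
    have "?d \<in> cocycles G 2"
      using G.coboundaries_2_subset coboundaries_2I[OF mus_in_cochains] by blast
    then show ?thesis using car unfolding cocycles_2_iff by blast
  qed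
  note approx = cobd_mus_approx[of \<mu>, OF D inv one]
  have "\<bar>?d [?b, ?c] - tau \<mu> [b, c]\<bar> \<le> 2 * D"
    using approx[of ?b ?c] car a b c by (simp add: p_section)
  moreover have "\<bar>?d [?a \<otimes>\<^bsub>G\<^esub> ?b, ?c] - tau \<mu> [a \<otimes>\<^bsub>Gm\<^esub> b, c]\<bar> \<le> 2 * D"
    using approx[of "?a \<otimes>\<^bsub>G\<^esub> ?b" ?c] car a b c by (simp add: p_section)
  moreover have "\<bar>?d [?a, ?b \<otimes>\<^bsub>G\<^esub> ?c] - tau \<mu> [a, b \<otimes>\<^bsub>Gm\<^esub> c]\<bar> \<le> 2 * D"
    using approx[of ?a "?b \<otimes>\<^bsub>G\<^esub> ?c"] car a b c by (simp add: p_section)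
  moreover have "\<bar>?d [?a, ?b] - tau \<mu> [a, b]\<bar> \<le> 2 * D"
    using approx[of ?a ?b] car a b c by (simp add: p_section)
  ultimately show ?thesis
    unfolding dtau_rep_def cobd_2[OF a b c] using coc by linarith
qed

section \<open>Linearity of \<open>tau\<close>, and its values on homomorphisms and
  restrictions\<close>

lemma mus_add: "mus (\<mu> + \<nu>) = mus \<mu> + mus \<nu>"
  by (rule ext) (simp add: mu_s_cochain_def mu_s_def)

lemma mus_fscale: "mus (fscale c \<mu>) = fscale c (mus \<mu>)"
  by (rule ext) (simp add: mu_s_cochain_def mu_s_def fscale_def)

lemma tau_add: "tau (\<mu> + \<nu>) = tau \<mu> + tau \<nu>"
  by (simp only: tau_rep_def mus_add cobd_add pullback_add)

lemma tau_fscale: "tau (fscale c \<mu>) = fscale c (tau \<mu>)"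
  by (simp only: tau_rep_def mus_fscale cobd_fscale pullback_fscale)

lemma dtau_add: "dtau (\<mu> + \<nu>) = dtau \<mu> + dtau \<nu>"
  by (simp only: dtau_rep_def tau_add cobd_add)

lemma dtau_fscale: "dtau (fscale c \<mu>) = fscale c (dtau \<mu>)"
  by (simp only: dtau_rep_def tau_fscale cobd_fscale)

lemma H1NG_subset_QNG: "H1NG N G i \<subseteq> QNG N G i"
  using N.homs_R_subset_hqm unfolding H1NG_def QNG_def by blast

lemma QNG_D:
  assumes "\<mu> \<in> QNG N G i"
  shows "\<mu> \<in> hqm N" "G_invariant N G i \<mu>" "\<mu> \<one>\<^bsub>N\<^esub> = 0"
  using assms N.hqm_one by (auto simp: QNG_def)

lemma restrQG_subset_QNG: "restrQG N G i \<subseteq> QNG N G i"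
proof
  fix \<mu> assume "\<mu> \<in> restrQG N G i"
  then obtain \<psi> where \<psi>: "\<psi> \<in> hqm G" and \<mu>: "\<mu> = (\<lambda>n. if n \<in> carrier N then \<psi> (i n) else 0)"
    by (auto simp: restrQG_def)
  obtain D where D: "\<forall>x\<in>carrier G. \<forall>y\<in>carrier G. \<bar>\<psi> (x \<otimes>\<^bsub>G\<^esub> y) - \<psi> x - \<psi> y\<bar> \<le> D"
    using \<psi> by (rule hqm_defect)
  have "\<mu> \<in> hqm N"
    unfolding hqm_def mem_Collect_eq
  proof (intro conjI exI[of _ D] ballI allI impI)
    fix x y assume "x \<in> carrier N" "y \<in> carrier N"
    then show "\<bar>\<mu> (x \<otimes>\<^bsub>N\<^esub> y) - \<mu> x - \<mu> y\<bar> \<le> D" using D by (simp add: \<mu>)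
  next
    fix x and k :: int assume "x \<in> carrier N"
    then show "\<mu> (x [^]\<^bsub>N\<^esub> k) = of_int k * \<mu> x"
      by (simp add: \<mu> i.hom_int_pow hqm_int_pow[OF \<psi>])
  qed (simp add: \<mu>)
  moreover have "G_invariant N G i \<mu>"
    unfolding G_invariant_def by (simp add: \<mu> G.hqm_conj[OF \<psi>])
  ultimately show "\<mu> \<in> QNG N G i" by (simp add: QNG_def)
qed

text \<open>The target represents \<open>Ker c^3\<close>: a bounded cocycle that is the coboundary
  of a possibly unbounded cochain, here of \<open>\<tau>(\<mu>)\<close>.\<close>

lemma dtau_in_bcocycles:
  assumes "\<mu> \<in> QNG N G i"
  shows "dtau \<mu> \<in> bcocycles Gm 3 \<inter> coboundaries Gm 3"
proof -
  obtain D where D: "\<forall>x\<in>carrier N. \<forall>y\<in>carrier N. \<bar>\<mu> (x \<otimes>\<^bsub>N\<^esub> y) - \<mu> x - \<mu> y\<bar> \<le> D"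
    using QNG_D(1)[OF assms] by (rule hqm_defect)
  have "dtau \<mu> \<in> cochains Gm 3"
    unfolding dtau_rep_def using cobd_in_cochains[of Gm 2 "tau \<mu>"] by simp
  then have "dtau \<mu> \<in> bcochains Gm 3"
    by (rule bcochains_3I) (rule dtau_approx[of \<mu>, OF D QNG_D(2,3)[OF assms]])
  moreover have "cobd Gm 3 (dtau \<mu>) = fzero"
    unfolding dtau_rep_def fzero_eq_zero by (rule Gm.cobd_cobd_2)
  moreover have "dtau \<mu> \<in> coboundaries Gm 3"
    unfolding coboundaries_3_iff dtau_rep_def using tau_in_cochains by blast
  ultimately show ?thesis by (simp add: bcocycles_def)
qed

text \<open>The defect is zero, so both approximations become exact. This is, up to sign, the
  classical transgression from \<open>H^1(N)^G\<close> to \<open>H^2(\<Gamma>)\<close>, whose image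
  dies in \<open>H^2(G)\<close>.\<close>

lemma H1NG_tau:
  assumes h: "h \<in> H1NG N G i"
  shows "tau h \<in> cocycles Gm 2" "pullback p G 2 (tau h) = cobd G 1 (mus h)"
proof -
  note hQ = subsetD[OF H1NG_subset_QNG h]
  have D: "\<forall>x\<in>carrier N. \<forall>y\<in>carrier N. \<bar>h (x \<otimes>\<^bsub>N\<^esub> y) - h x - h y\<bar> \<le> 0"
    using h by (simp add: H1NG_def homs_R_def)
  note D = D QNG_D(2,3)[OF hQ]
  show "tau h \<in> cocycles Gm 2"
    unfolding cocycles_2_iff
  proof (intro conjI ballI tau_in_cochains)
    fix a b c assume c: "a \<in> carrier Gm" "b \<in> carrier Gm" "c \<in> carrier Gm"
    show "tau h [b, c] - tau h [a \<otimes>\<^bsub>Gm\<^esub> b, c] + tau h [a, b \<otimes>\<^bsub>Gm\<^esub> c] - tau h [a, b] = 0"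
      using dtau_approx[of h, OF D c] unfolding dtau_rep_def cobd_2[OF c] by simp
  qed
  have co: "cobd G 1 (mus h) \<in> cochains G 2"
    using cobd_in_cochains[of G 1] by (simp add: numeral_2_eq_2)
  show "pullback p G 2 (tau h) = cobd G 1 (mus h)"
  proof (rule cochains_2_eqI[OF pullback_in_cochains co])
    fix x y assume c: "x \<in> carrier G" "y \<in> carrier G"
    have "cobd G 1 (mus h) [x, y] = tau h [p x, p y]"
      using cobd_mus_approx[of h, OF D c] by simp
    then show "pullback p G 2 (tau h) [x, y] = cobd G 1 (mus h) [x, y]"
      using c by (simp add: pullback_def)
  qed
qed

text \<open>For restrictions the class of \<open>\<tau>(\<mu>)\<close> modulo bounded cochains
  vanishes, since \<open>\<psi>\<close> is defined on all of \<open>G\<close> and splits the factor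
  set into its three factors up to a bounded error.\<close>

lemma restrQG_tau:
  assumes "\<mu> \<in> restrQG N G i"
  obtains u b where "u \<in> cochains Gm 1" "b \<in> bcochains Gm 2" "tau \<mu> = b - cobd Gm 1 u"
proof -
  obtain \<psi> where \<psi>: "\<psi> \<in> hqm G" and \<mu>: "\<mu> = (\<lambda>n. if n \<in> carrier N then \<psi> (i n) else 0)"
    using assms by (auto simp: restrQG_def)
  obtain D where D: "\<forall>x\<in>carrier G. \<forall>y\<in>carrier G. \<bar>\<psi> (x \<otimes>\<^bsub>G\<^esub> y) - \<psi> x - \<psi> y\<bar> \<le> D"
    using \<psi> by (rule hqm_defect)
  have one: "\<mu> \<one>\<^bsub>N\<^esub> = 0" using G.hqm_one[OF \<psi>] by (simp add: \<mu>)
  \<comment> \<open>The primitive is \<open>\<psi>\<close> composed with the section; the two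
    splittings of the factor set account for the bound \<open>2 * D\<close>.\<close>
  define u where "u xs = (if length xs = 1 \<and> set xs \<subseteq> carrier Gm then \<psi> (s (hd xs)) else 0)" for xs
  have u: "u \<in> cochains Gm 1" by (simp add: cochains_iff u_def)
  have ua: "u [a] = \<psi> (s a)" if "a \<in> carrier Gm" for a using that by (simp add: u_def)
  have co: "cobd Gm 1 u \<in> cochains Gm 2"
    using cobd_in_cochains[of Gm 1] by (simp add: numeral_2_eq_2)
  have "tau \<mu> + cobd Gm 1 u \<in> bcochains Gm 2"
  proof (rule bcochains_2I)
    show "tau \<mu> + cobd Gm 1 u \<in> cochains Gm 2"
      by (rule fs.subspace_add[OF subspace_cochains tau_in_cochains co])
    fix a b assume a: "a \<in> carrier Gm" and b: "b \<in> carrier Gm"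
    let ?w = "factor_set a b"
    have w: "?w \<in> ker" by (rule factor_set_in_ker[OF a b])
    then obtain n where n: "n \<in> carrier N" "?w = i n" by (rule kerE)
    have "tau \<mu> [a, b] = - \<psi> ?w"
      unfolding tau_apply[of \<mu>, OF one a b] using n by (simp add: on_kernel_i) (simp add: \<mu>)
    moreover have "\<bar>\<psi> ?w - \<psi> (s a \<otimes>\<^bsub>G\<^esub> s b) - \<psi> (inv\<^bsub>G\<^esub> s (a \<otimes>\<^bsub>Gm\<^esub> b))\<bar> \<le> D"
      using D a b section_carrier by simp
    moreover have "\<bar>\<psi> (s a \<otimes>\<^bsub>G\<^esub> s b) - \<psi> (s a) - \<psi> (s b)\<bar> \<le> D"
      using D a b section_carrier by simp
    moreover have "\<psi> (inv\<^bsub>G\<^esub> s (a \<otimes>\<^bsub>Gm\<^esub> b)) = - \<psi> (s (a \<otimes>\<^bsub>Gm\<^esub> b))"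
      using G.hqm_inv[OF \<psi>] a b section_carrier by simp
    moreover have "cobd Gm 1 u [a, b] = \<psi> (s b) - \<psi> (s (a \<otimes>\<^bsub>Gm\<^esub> b)) + \<psi> (s a)"
      unfolding cobd_1[OF a b] using a b by (simp add: ua)
    ultimately show "\<bar>(tau \<mu> + cobd Gm 1 u) [a, b]\<bar> \<le> 2 * D"
      unfolding plus_fun_apply by linarith
  qed
  from that[OF u this] show ?thesis by (simp only: add_diff_cancel_right')
qed

end

section \<open>The kernel of the connecting map\<close>

context group_extension
begin

text \<open>When one argument lies in the kernel, \<open>e(p x, p y)\<close> is the constant
  \<open>e(1, 1)\<close>; so \<open>\<phi>\<close> is additive along the kernel up to that constant
  and \<open>A\<close>. Having the kernel element on either side allows conjugates to be
  compared.\<close>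

lemma ker_translate:
  assumes e: "e \<in> cocycles Gm 2" and A: "\<And>x y. x \<in> carrier G \<Longrightarrow> y \<in> carrier G \<Longrightarrow>
      \<bar>\<phi> [y] - \<phi> [x \<otimes>\<^bsub>G\<^esub> y] + \<phi> [x] - e [p x, p y]\<bar> \<le> A"
    and g: "g \<in> carrier G" and n: "n \<in> ker"
  shows "\<bar>\<phi> [g \<otimes>\<^bsub>G\<^esub> n] - (\<phi> [g] + \<phi> [n] - e [\<one>\<^bsub>Gm\<^esub>, \<one>\<^bsub>Gm\<^esub>])\<bar> \<le> A"
    and "\<bar>\<phi> [n \<otimes>\<^bsub>G\<^esub> g] - (\<phi> [n] + \<phi> [g] - e [\<one>\<^bsub>Gm\<^esub>, \<one>\<^bsub>Gm\<^esub>])\<bar> \<le> A"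
proof -
  have c: "n \<in> carrier G" "p n = \<one>\<^bsub>Gm\<^esub>" "p g \<in> carrier Gm" using g n by (simp_all add: ker_iff)
  note one = Gm.cocycle_2_one[OF e c(3)]
  show "\<bar>\<phi> [g \<otimes>\<^bsub>G\<^esub> n] - (\<phi> [g] + \<phi> [n] - e [\<one>\<^bsub>Gm\<^esub>, \<one>\<^bsub>Gm\<^esub>])\<bar> \<le> A"
    using A[OF g c(1)] one unfolding c(2) by linarith
  show "\<bar>\<phi> [n \<otimes>\<^bsub>G\<^esub> g] - (\<phi> [n] + \<phi> [g] - e [\<one>\<^bsub>Gm\<^esub>, \<one>\<^bsub>Gm\<^esub>])\<bar> \<le> A"
    using A[OF c(1) g] one unfolding c(2) by linarith
qed

text \<open>The injectivity half: \<open>\<phi>\<close> restricted to \<open>N\<close> gives an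
  invariant homomorphism, and \<open>\<mu>\<close> differs from it by the restriction of a
  quasimorphism of \<open>G\<close>.\<close>

lemma exact_pullback_imp_mem_ssum:
  assumes \<mu>: "\<mu> \<in> QNG N G i" and e: "e \<in> cocycles Gm 2" and b: "b \<in> bcochains Gm 2"
    and tau: "tau \<mu> = e + b" and pe: "pullback p G 2 e = cobd G 1 \<phi>"
  shows "\<mu> \<in> ssum (H1NG N G i) (restrQG N G i)"
proof -
  note \<mu>Q = QNG_D[OF \<mu>]
  obtain D where D: "\<forall>x\<in>carrier N. \<forall>y\<in>carrier N. \<bar>\<mu> (x \<otimes>\<^bsub>N\<^esub> y) - \<mu> x - \<mu> y\<bar> \<le> D"
    using \<mu>Q(1) by (rule hqm_defect)
  obtain M where M: "\<forall>xs. \<bar>b xs\<bar> \<le> M" using b by (rule bcochainsE)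
  define e0 where "e0 = e [\<one>\<^bsub>Gm\<^esub>, \<one>\<^bsub>Gm\<^esub>]"
  have d\<phi>: "\<phi> [y] - \<phi> [x \<otimes>\<^bsub>G\<^esub> y] + \<phi> [x] = e [p x, p y]"
    if "x \<in> carrier G" "y \<in> carrier G" for x y
    using fun_cong[OF pe, of "[x, y]"] that unfolding cobd_1[OF that] by (simp add: pullback_def)
  \<comment> \<open>With error bound \<open>0\<close> the translation estimates are
    equalities.\<close>
  have left: "\<phi> [g \<otimes>\<^bsub>G\<^esub> n] = \<phi> [g] + \<phi> [n] - e0"
    and right: "\<phi> [n \<otimes>\<^bsub>G\<^esub> g] = \<phi> [n] + \<phi> [g] - e0" if "g \<in> carrier G" "n \<in> ker" for g n
    using ker_translate[OF e, of \<phi> 0 g n] d\<phi> that unfolding e0_def by simp_all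
  \<comment> \<open>The shift by \<open>e0\<close> compensates
    \<open>\<phi>(x y) = \<phi>(x) + \<phi>(y) - e0\<close> on the kernel and makes \<open>h\<close>
    additive.\<close>
  define h where "h n = (if n \<in> carrier N then \<phi> [i n] - e0 else 0)" for n
  have hH: "h \<in> homs_R N"
    unfolding homs_R_def mem_Collect_eq
  proof (intro conjI allI impI ballI)
    fix x y assume xy: "x \<in> carrier N" "y \<in> carrier N"
    then show "h (x \<otimes>\<^bsub>N\<^esub> y) = h x + h y"
      using left[of "i x" "i y"] i_in_ker[of y] by (simp add: h_def)
  qed (simp add: h_def)
  have "G_invariant N G i h"
    unfolding G_invariant_def
  proof (intro ballI impI)
    fix g n m assume g: "g \<in> carrier G" and n: "n \<in> carrier N" and m: "m \<in> carrier N"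
      and eq: "i m = g \<otimes>\<^bsub>G\<^esub> i n \<otimes>\<^bsub>G\<^esub> inv\<^bsub>G\<^esub> g"
    \<comment> \<open>This element is evaluated by \<open>right\<close> and by \<open>left\<close>;
      \<open>\<phi>(g)\<close> cancels.\<close>
    have "i m \<otimes>\<^bsub>G\<^esub> g = g \<otimes>\<^bsub>G\<^esub> i n"
      unfolding eq using g n by (simp add: G.m_assoc)
    then show "h m = h n"
      using left[OF g i_in_ker[OF n]] right[OF g i_in_ker[OF m]] n m by (simp add: h_def)
  qed
  with hH have h: "h \<in> H1NG N G i" by (simp add: H1NG_def)
  \<comment> \<open>\<open>\<delta>\<phi>\<close> is the pullback of \<open>e\<close>, and
    \<open>\<delta>\<mu>_s\<close> is within \<open>2 * D\<close> of the pullback of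
    \<open>e + b\<close>.\<close>
  have quasi: "\<bar>(\<phi> [x \<otimes>\<^bsub>G\<^esub> y] - mus \<mu> [x \<otimes>\<^bsub>G\<^esub> y]) - (\<phi> [x] - mus \<mu> [x]) - (\<phi> [y] - mus \<mu> [y])\<bar> \<le> 2 * D + M"
    if xy: "x \<in> carrier G" "y \<in> carrier G" for x y
  proof -
    have "tau \<mu> [p x, p y] = e [p x, p y] + b [p x, p y]" by (simp add: tau)
    then show ?thesis
      using cobd_mus_approx[of \<mu>, OF D \<mu>Q(2,3) xy] d\<phi>[OF xy] spec[OF M, of "[p x, p y]"]
      unfolding cobd_1[OF xy] by linarith
  qed
  obtain \<psi> where \<psi>: "\<psi> \<in> hqm G" and close: "\<forall>x\<in>carrier G. \<bar>\<psi> x - (\<phi> [x] - mus \<mu> [x])\<bar> \<le> 2 * D + M"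
    by (rule G.homogenization[of "\<lambda>x. \<phi> [x] - mus \<mu> [x]", OF quasi])
  define r where "r = (\<lambda>n. if n \<in> carrier N then \<psi> (i n) else 0)"
  have r: "r \<in> restrQG N G i" unfolding restrQG_def r_def using \<psi> by (rule imageI)
  have hq: "h \<in> hqm N" using h H1NG_subset_QNG QNG_D(1) by blast
  have rq: "r \<in> hqm N" using r restrQG_subset_QNG QNG_D(1) by blast
  have "\<mu> n = h n - r n" for n
  proof (cases "n \<in> carrier N")
    case False
    then show ?thesis using hqm_outside[OF \<mu>Q(1)] by (simp add: h_def r_def)
  next
    case n: True
    \<comment> \<open>On \<open>N\<close> the function \<open>\<phi> - \<mu>_s\<close> equals
      \<open>h + e0 - \<mu>\<close>, so \<open>\<mu>\<close> and \<open>h - r\<close> are at bounded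
      distance; homogeneity along the powers of \<open>n\<close> gives equality.\<close>
    have "\<bar>real k * \<mu> n - real k * (h n - r n)\<bar> \<le> 2 * D + M + \<bar>e0\<bar>" for k
    proof -
      let ?m = "n [^]\<^bsub>N\<^esub> k"
      have m: "?m \<in> carrier N" using n by simp
      have "\<bar>\<psi> (i ?m) - (\<phi> [i ?m] - mus \<mu> [i ?m])\<bar> \<le> 2 * D + M"
        by (rule bspec[OF close i.hom_closed[OF m]])
      then have "\<bar>\<mu> ?m - (h ?m - r ?m)\<bar> \<le> 2 * D + M + \<bar>e0\<bar>"
        unfolding mus_i[OF m] using m by (simp add: h_def r_def)
      then show ?thesis
        using hqm_nat_pow[OF \<mu>Q(1) n, of k] hqm_nat_pow[OF hq n, of k] hqm_nat_pow[OF rq n, of k]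
        by (simp add: right_diff_distrib)
    qed
    then show ?thesis by (rule scaled_bounded_imp_eq)
  qed
  then have "\<mu> = h + (- r)" by auto
  moreover have "- r \<in> restrQG N G i" by (rule fs.subspace_neg[OF subspace_restrQG r])
  ultimately show ?thesis unfolding ssum_iff using h by blast
qed

text \<open>The surjectivity half: \<open>\<phi>\<close> is a quasimorphism on \<open>N\<close>,
  almost invariant under conjugation, and \<open>\<mu>\<close> is its homogenization; the values of
  \<open>\<phi>\<close> on the section give the correction \<open>u\<close>.\<close>

lemma bounded_pullback_imp_tau:
  assumes \<alpha>: "\<alpha> \<in> bcochains G 2" and c: "c \<in> cocycles Gm 2"
    and eq: "pullback p G 2 c = \<alpha> + cobd G 1 \<phi>"
  obtains \<mu> u b where "\<mu> \<in> QNG N G i" "u \<in> cochains Gm 1" "b \<in> bcochains Gm 2"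
    "tau \<mu> = (c - cobd Gm 1 u) + b"
proof -
  obtain A where A: "\<forall>xs. \<bar>\<alpha> xs\<bar> \<le> A" using \<alpha> by (rule bcochainsE)
  define c0 where "c0 = c [\<one>\<^bsub>Gm\<^esub>, \<one>\<^bsub>Gm\<^esub>]"
  have d\<phi>: "\<bar>\<phi> [y] - \<phi> [x \<otimes>\<^bsub>G\<^esub> y] + \<phi> [x] - c [p x, p y]\<bar> \<le> A"
    if "x \<in> carrier G" "y \<in> carrier G" for x y
  proof -
    have "c [p x, p y] = \<alpha> [x, y] + (\<phi> [y] - \<phi> [x \<otimes>\<^bsub>G\<^esub> y] + \<phi> [x])"
      using fun_cong[OF eq, of "[x, y]"] that unfolding plus_fun_apply cobd_1[OF that]
      by (simp add: pullback_def)
    then show ?thesis using spec[OF A, of "[x, y]"] by linarith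
  qed
  \<comment> \<open>The constant \<open>c(1, 1)\<close> is absorbed into the defect, as only
    boundedness matters here.\<close>
  define B where "B = A + \<bar>c0\<bar>"
  have left: "\<bar>\<phi> [g \<otimes>\<^bsub>G\<^esub> n] - \<phi> [g] - \<phi> [n]\<bar> \<le> B"
    and right: "\<bar>\<phi> [n \<otimes>\<^bsub>G\<^esub> g] - \<phi> [n] - \<phi> [g]\<bar> \<le> B" if "g \<in> carrier G" "n \<in> ker" for g n
    using ker_translate[OF c d\<phi> that] unfolding B_def c0_def[symmetric] by linarith+
  have quasi: "\<bar>\<phi> [i (x \<otimes>\<^bsub>N\<^esub> y)] - \<phi> [i x] - \<phi> [i y]\<bar> \<le> B"
    if "x \<in> carrier N" "y \<in> carrier N" for x y
    using left[of "i x" "i y"] that i_in_ker[of y] by simp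
  obtain \<mu> where \<mu>: "\<mu> \<in> hqm N" and close: "\<forall>n\<in>carrier N. \<bar>\<mu> n - \<phi> [i n]\<bar> \<le> B"
    by (rule N.homogenization[of "\<lambda>n. \<phi> [i n]", OF quasi])
  have "G_invariant N G i \<mu>"
    unfolding G_invariant_def
  proof (intro ballI impI)
    fix g n m assume g: "g \<in> carrier G" and n: "n \<in> carrier N" and m: "m \<in> carrier N"
      and conj: "i m = g \<otimes>\<^bsub>G\<^esub> i n \<otimes>\<^bsub>G\<^esub> inv\<^bsub>G\<^esub> g"
    \<comment> \<open>\<open>2 * B\<close> for the comparison of \<open>\<phi>\<close> at the two
      conjugates and \<open>B\<close> for each passage from \<open>\<mu>\<close> to
      \<open>\<phi>\<close>.\<close>
    have "\<bar>real k * \<mu> m - real k * \<mu> n\<bar> \<le> 4 * B" for k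
    proof -
      let ?n = "n [^]\<^bsub>N\<^esub> k" and ?m = "m [^]\<^bsub>N\<^esub> k"
      have c: "?n \<in> carrier N" "?m \<in> carrier N" using n m by simp_all
      have "i ?m = g \<otimes>\<^bsub>G\<^esub> i ?n \<otimes>\<^bsub>G\<^esub> inv\<^bsub>G\<^esub> g"
        using n m by (simp add: i.hom_nat_pow conj G.conj_nat_pow[OF g])
      then have "i ?m \<otimes>\<^bsub>G\<^esub> g = g \<otimes>\<^bsub>G\<^esub> i ?n"
        using g c by (simp add: G.m_assoc)
      then have "\<bar>\<phi> [i ?m] - \<phi> [i ?n]\<bar> \<le> 2 * B"
        using left[OF g i_in_ker[OF c(1)]] right[OF g i_in_ker[OF c(2)]] by (simp only:)
      then show ?thesis
        using bspec[OF close c(1)] bspec[OF close c(2)]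
        unfolding hqm_nat_pow[OF \<mu> n] hqm_nat_pow[OF \<mu> m] by linarith
    qed
    then show "\<mu> m = \<mu> n" by (rule scaled_bounded_imp_eq)
  qed
  with \<mu> have \<mu>Q: "\<mu> \<in> QNG N G i" by (simp add: QNG_def)
  define u where "u xs = (if length xs = 1 \<and> set xs \<subseteq> carrier Gm then \<phi> [s (hd xs)] else 0)" for xs
  have u: "u \<in> cochains Gm 1" by (simp add: cochains_iff u_def)
  have ua: "u [a] = \<phi> [s a]" if "a \<in> carrier Gm" for a using that by (simp add: u_def)
  have cu: "cobd Gm 1 u \<in> cochains Gm 2"
    using cobd_in_cochains[of Gm 1] by (simp add: numeral_2_eq_2)
  have cc: "c \<in> cochains Gm 2" using c by (simp add: cocycles_def)
  have "tau \<mu> - (c - cobd Gm 1 u) \<in> bcochains Gm 2"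
  proof (rule bcochains_2I)
    show "tau \<mu> - (c - cobd Gm 1 u) \<in> cochains Gm 2"
      by (intro fs.subspace_diff[OF subspace_cochains] tau_in_cochains cc cu)
    fix a b assume a: "a \<in> carrier Gm" and b: "b \<in> carrier Gm"
    let ?w = "factor_set a b" and ?ab = "s (a \<otimes>\<^bsub>Gm\<^esub> b)"
    have car: "s a \<in> carrier G" "s b \<in> carrier G" "?ab \<in> carrier G"
      using a b section_carrier by simp_all
    have w: "?w \<in> ker" by (rule factor_set_in_ker[OF a b])
    then obtain n where n: "n \<in> carrier N" "?w = i n" by (rule kerE)
    have "tau \<mu> [a, b] = - \<mu> n"
      unfolding tau_apply[of \<mu>, OF QNG_D(3)[OF \<mu>Q] a b] n(2) on_kernel_i[OF n(1)] ..
    moreover have "\<bar>\<mu> n - \<phi> [?w]\<bar> \<le> B" unfolding n(2) by (rule bspec[OF close n(1)])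
    \<comment> \<open>Through this product, \<open>right\<close> expresses \<open>\<phi>(?w)\<close>
      by the values at \<open>s a s b\<close> and \<open>s(a b)\<close>; \<open>d\<phi>\<close> then
      turns \<open>-\<phi>(?w)\<close> into \<open>c - \<delta>u\<close> up to \<open>B + A\<close>,
      and the passage from \<open>\<mu>\<close> to \<open>\<phi>\<close> adds another
      \<open>B\<close>.\<close>
    moreover have "?w \<otimes>\<^bsub>G\<^esub> ?ab = s a \<otimes>\<^bsub>G\<^esub> s b" using car by (simp add: G.m_assoc)
    then have "\<bar>\<phi> [s a \<otimes>\<^bsub>G\<^esub> s b] - \<phi> [?w] - \<phi> [?ab]\<bar> \<le> B"
      using right[OF car(3) w] by (simp only:)
    moreover have "\<bar>\<phi> [s b] - \<phi> [s a \<otimes>\<^bsub>G\<^esub> s b] + \<phi> [s a] - c [a, b]\<bar> \<le> A"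
      using d\<phi>[OF car(1,2)] a b by (simp add: p_section)
    moreover have "cobd Gm 1 u [a, b] = \<phi> [s b] - \<phi> [?ab] + \<phi> [s a]"
      unfolding cobd_1[OF a b] using a b by (simp add: ua)
    ultimately show "\<bar>(tau \<mu> - (c - cobd Gm 1 u)) [a, b]\<bar> \<le> 2 * B + A"
      unfolding minus_apply by linarith
  qed
  then show ?thesis by (rule that[OF \<mu>Q u]) simp
qed

section \<open>The kernel of \<open>dtau\<close> and the spaces compared with it\<close>

definition dtau_kernel :: "('n \<Rightarrow> real) set" where
  "dtau_kernel = {\<mu> \<in> QNG N G i. dtau \<mu> \<in> bcoboundaries Gm 3}"

lemma subspace_dtau_kernel: "fs.subspace dtau_kernel"
proof (rule fs.subspaceI)
  have "dtau 0 = 0" using dtau_fscale[of 0 0] by (simp only: fs.scale_zero_left)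
  then show "0 \<in> dtau_kernel"
    by (simp only: dtau_kernel_def mem_Collect_eq
        fs.subspace_0[OF subspace_QNG] fs.subspace_0[OF subspace_bcoboundaries])
next
  fix x y assume "x \<in> dtau_kernel" "y \<in> dtau_kernel"
  then show "x + y \<in> dtau_kernel"
    by (simp only: dtau_kernel_def mem_Collect_eq dtau_add
        fs.subspace_add[OF subspace_QNG] fs.subspace_add[OF subspace_bcoboundaries])
next
  fix c x assume "x \<in> dtau_kernel"
  then show "fscale c x \<in> dtau_kernel"
    by (simp only: dtau_kernel_def mem_Collect_eq dtau_fscale
        fs.subspace_scale[OF subspace_QNG] fs.subspace_scale[OF subspace_bcoboundaries])
qed

lemma dtau_kernel_subset: "dtau_kernel \<subseteq> QNG N G i"
  by (simp add: dtau_kernel_def subset_eq)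

text \<open>A cocycle at bounded distance from \<open>\<tau>(\<mu>)\<close> leaves the bounded
  difference \<open>b\<close> as a primitive of \<open>\<delta>\<tau>(\<mu>)\<close>.\<close>

lemma dtau_kernelI:
  assumes "\<mu> \<in> QNG N G i" "c \<in> cocycles Gm 2" "b \<in> bcochains Gm 2" "tau \<mu> = c + b"
  shows "\<mu> \<in> dtau_kernel"
proof -
  have "dtau \<mu> = cobd Gm 2 b"
    using assms(2) by (simp only: dtau_rep_def assms(4) cobd_add cocycles_def mem_Collect_eq
        fzero_eq_zero add_0)
  then show ?thesis
    using assms(1,3) by (simp only: dtau_kernel_def mem_Collect_eq bcoboundaries_3_iff) blast
qed

text \<open>Modulo bounded cochains and coboundaries only the homomorphism summand contributes to
  \<open>\<tau>\<close>, by \<open>restrQG_tau\<close>.\<close>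

lemma ssum_tau:
  assumes "\<mu> \<in> ssum (H1NG N G i) (restrQG N G i)"
  obtains h u b where "h \<in> H1NG N G i" "u \<in> cochains Gm 1" "b \<in> bcochains Gm 2"
    "tau \<mu> = (tau h - cobd Gm 1 u) + b"
proof -
  obtain h r where h: "h \<in> H1NG N G i" and r: "r \<in> restrQG N G i" and \<mu>: "\<mu> = h + r"
    using assms unfolding ssum_iff by blast
  obtain u b where u: "u \<in> cochains Gm 1" "b \<in> bcochains Gm 2" "tau r = b - cobd Gm 1 u"
    using r by (rule restrQG_tau)
  show ?thesis
    by (rule that[OF h u(1,2)]) (simp add: \<mu> tau_add u(3))
qed

lemma ssum_subset_dtau_kernel: "ssum (H1NG N G i) (restrQG N G i) \<subseteq> dtau_kernel"
proof
  fix \<mu> assume \<mu>: "\<mu> \<in> ssum (H1NG N G i) (restrQG N G i)"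
  have \<mu>Q: "\<mu> \<in> QNG N G i"
    using ssum_least[OF subspace_QNG H1NG_subset_QNG restrQG_subset_QNG] \<mu> by (rule subsetD)
  obtain h u b where *: "h \<in> H1NG N G i" "u \<in> cochains Gm 1" "b \<in> bcochains Gm 2"
    "tau \<mu> = (tau h - cobd Gm 1 u) + b"
    using \<mu> by (rule ssum_tau)
  have "tau h - cobd Gm 1 u \<in> cocycles Gm 2"
    by (rule fs.subspace_diff[OF subspace_cocycles H1NG_tau(1)[OF *(1)]
          subsetD[OF Gm.coboundaries_2_subset coboundaries_2I[OF *(2)]]])
  from dtau_kernelI[OF \<mu>Q this *(3,4)] show "\<mu> \<in> dtau_kernel" .
qed

text \<open>Adding the coboundaries turns a space of cocycles into the full preimage of its image in
  \<open>H^2(G)\<close>; the intersection is thus the preimage of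
  \<open>Im c_G^2 \<inter> Im p^*\<close>.\<close>

definition comparison_image :: "('a list \<Rightarrow> real) set" where
  "comparison_image = ssum (bcocycles G 2) (coboundaries G 2)
    \<inter> ssum (pullback p G 2 ` cocycles Gm 2) (coboundaries G 2)"

text \<open>The preimage of \<open>Im (p^* \<circ> c_\<Gamma>^2)\<close>. As both preimages contain
  the coboundaries, their quotient is the second term of the formula.\<close>

definition bounded_pullbacks :: "('a list \<Rightarrow> real) set" where
  "bounded_pullbacks = ssum (pullback p G 2 ` bcocycles Gm 2) (coboundaries G 2)"

lemma subspace_bounded_pullbacks: "fs.subspace bounded_pullbacks"
  unfolding bounded_pullbacks_def
  by (intro subspace_ssum subspace_linear_image subspace_bcocycles subspace_coboundaries
      pullback_add pullback_fscale)

lemma subspace_comparison_image: "fs.subspace comparison_image"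
  unfolding comparison_image_def
  by (intro fs.subspace_inter subspace_ssum subspace_linear_image subspace_bcocycles
      subspace_cocycles subspace_coboundaries pullback_add pullback_fscale)

lemma pullback_bcocycles: "pullback p G 2 ` bcocycles Gm 2 \<subseteq> bcocycles G 2"
proof
  fix x assume "x \<in> pullback p G 2 ` bcocycles Gm 2"
  then obtain c where c: "c \<in> bcocycles Gm 2" and x: "x = pullback p G 2 c" by (rule imageE)
  obtain M where M: "\<forall>xs. \<bar>c xs\<bar> \<le> M"
    using c by (auto simp: bcocycles_def elim: bcochainsE)
  have "x \<in> bcochains G 2"
    unfolding x
  proof (rule bcochainsI[OF pullback_in_cochains])
    fix xs assume "length xs = 2" "set xs \<subseteq> carrier G"
    then show "\<bar>pullback p G 2 c xs\<bar> \<le> M" using M by (simp add: pullback_def)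
  qed
  moreover have "x \<in> cocycles G 2"
    unfolding x by (rule pullback_2_cocycles[OF G.is_monoid p_hom subsetD[OF bcocycles_subset c]])
  ultimately show "x \<in> bcocycles G 2" by (simp add: bcocycles_def cocycles_def)
qed

lemma bounded_pullbacks_subset: "bounded_pullbacks \<subseteq> comparison_image"
  unfolding bounded_pullbacks_def comparison_image_def
  by (intro Int_greatest ssum_mono_left pullback_bcocycles image_mono bcocycles_subset)

lemma coboundaries_subset_bounded_pullbacks: "coboundaries G 2 \<subseteq> bounded_pullbacks"
  unfolding bounded_pullbacks_def
  by (intro subset_ssum_right subspace_linear_image subspace_bcocycles pullback_add pullback_fscale)

lemma comparison_image_subset: "comparison_image \<subseteq> cocycles G 2"
  unfolding comparison_image_def
  by (intro le_infI1 ssum_least subspace_cocycles bcocycles_subset G.coboundaries_2_subset)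

text \<open>The isomorphism theorem for \<open>\<mu> \<mapsto> [dtau \<mu>]\<close>, stated through
  the relation that \<open>y\<close> represents the class of \<open>dtau \<mu>\<close>.\<close>

lemma qdim_dtau_image:
  "(qdim (QNG N G i) dtau_kernel,
    qdim (ssum (dtau ` QNG N G i) (bcoboundaries Gm 3)) (bcoboundaries Gm 3)) \<in> ordIso"
proof (rule qdim_ordIso_linear_relation[where R = "\<lambda>\<mu> y. y - dtau \<mu> \<in> bcoboundaries Gm 3"])
  let ?B = "bcoboundaries Gm 3"
  have sB: "fs.subspace ?B" by (rule subspace_bcoboundaries)
  have sI: "fs.subspace (dtau ` QNG N G i)"
    by (intro subspace_linear_image subspace_QNG dtau_add dtau_fscale)
  have d0: "dtau 0 = 0" using dtau_fscale[of 0 0] by (simp only: fs.scale_zero_left)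
  show "fs.subspace dtau_kernel" "fs.subspace (QNG N G i)" "dtau_kernel \<subseteq> QNG N G i" "fs.subspace ?B"
    by (rule subspace_dtau_kernel subspace_QNG dtau_kernel_subset sB)+
  show "fs.subspace (ssum (dtau ` QNG N G i) ?B)" by (rule subspace_ssum[OF sI sB])
  show "?B \<subseteq> ssum (dtau ` QNG N G i) ?B" by (rule subset_ssum_right[OF sI])
  show "0 - dtau 0 \<in> ?B" unfolding d0 diff_zero by (rule fs.subspace_0[OF sB])
  show "x' + y' - dtau (x + y) \<in> ?B" if "x' - dtau x \<in> ?B" "y' - dtau y \<in> ?B" for x y x' y'
    using fs.subspace_add[OF sB that] by (simp only: dtau_add add_diff_add)
  show "fscale c x' - dtau (fscale c x) \<in> ?B" if "x' - dtau x \<in> ?B" for c x x'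
    using fs.subspace_scale[OF sB that, of c] by (simp only: dtau_fscale fs.scale_right_diff_distrib)
  show "\<exists>x'\<in>ssum (dtau ` QNG N G i) ?B. x' - dtau x \<in> ?B" if "x \<in> QNG N G i" for x
  proof (rule bexI)
    show "dtau x - dtau x \<in> ?B" unfolding diff_self by (rule fs.subspace_0[OF sB])
    show "dtau x \<in> ssum (dtau ` QNG N G i) ?B"
      by (rule subsetD[OF subset_ssum_left[OF sB] imageI[OF that]])
  qed
  show "\<exists>x\<in>QNG N G i. x' - dtau x \<in> ?B" if x': "x' \<in> ssum (dtau ` QNG N G i) ?B" for x'
  proof -
    obtain x b where "x \<in> QNG N G i" "b \<in> ?B" "x' = dtau x + b"
      using x' unfolding ssum_iff by blast
    then show ?thesis by (intro bexI[of _ x]) simp_all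
  qed
  show "x \<in> dtau_kernel \<longleftrightarrow> x' \<in> ?B" if "x' - dtau x \<in> ?B" "x \<in> QNG N G i" for x x'
  proof -
    have "x' \<in> ?B" if "dtau x \<in> ?B"
      using fs.subspace_add[OF sB \<open>x' - dtau x \<in> ?B\<close> that] by (simp only: diff_add_cancel)
    moreover have "dtau x \<in> ?B" if "x' \<in> ?B"
      using fs.subspace_diff[OF sB that \<open>x' - dtau x \<in> ?B\<close>] by (simp only: diff_diff_eq2 add_diff_cancel_left')
    ultimately show ?thesis using \<open>x \<in> QNG N G i\<close> by (auto simp: dtau_kernel_def)
  qed
qed

text \<open>Relates \<open>\<mu>\<close> to the cocycles on \<open>G\<close> cohomologous to the pullback of a cocycle on \<open>\<Gamma>\<close> at bounded
  distance from \<open>\<tau>(\<mu>)\<close>; such a cocycle exists exactly on the kernel of \<open>d \<circ> \<tau>\<close>.\<close>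

definition transgression :: "('n \<Rightarrow> real) \<Rightarrow> ('a list \<Rightarrow> real) \<Rightarrow> bool" where
  "transgression \<mu> x \<longleftrightarrow> (\<exists>c\<in>cocycles Gm 2. tau \<mu> - c \<in> bcochains Gm 2 \<and>
    x - pullback p G 2 c \<in> coboundaries G 2)"

text \<open>Membership in the kernel supplies a bounded \<open>b\<close> with the same coboundary as
  \<open>\<tau>(\<mu>)\<close>; subtracting it produces a cocycle.\<close>

lemma transgression_exists:
  assumes \<mu>: "\<mu> \<in> dtau_kernel"
  shows "\<exists>x\<in>comparison_image. transgression \<mu> x"
proof -
  have \<mu>Q: "\<mu> \<in> QNG N G i" using \<mu> by (simp add: dtau_kernel_def)
  obtain b where b: "b \<in> bcochains Gm 2" "dtau \<mu> = cobd Gm 2 b"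
    using \<mu> unfolding dtau_kernel_def bcoboundaries_3_iff by blast
  define c where "c = tau \<mu> - b"
  have "b \<in> cochains Gm 2" using b(1) by (simp add: bcochains_def)
  then have "c \<in> cochains Gm 2"
    unfolding c_def by (rule fs.subspace_diff[OF subspace_cochains tau_in_cochains])
  moreover have "cobd Gm 2 c = fzero"
    using b(2) unfolding c_def cobd_diff dtau_rep_def fzero_eq_zero by (simp only: diff_self)
  ultimately have c: "c \<in> cocycles Gm 2" by (simp add: cocycles_def)
  note pc = pullback_2_cocycles[OF G.is_monoid p_hom c]
  have dm: "cobd G 1 (mus \<mu>) \<in> coboundaries G 2" by (rule coboundaries_2I[OF mus_in_cochains])
  \<comment> \<open>Subtracting \<open>\<delta>\<mu>_s\<close> makes the pullback bounded, so its
    class comes from the bounded cohomology of \<open>G\<close>.\<close>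
  define \<beta> where "\<beta> = pullback p G 2 c - cobd G 1 (mus \<mu>)"
  have \<beta>c: "\<beta> \<in> cocycles G 2"
    unfolding \<beta>_def by (rule fs.subspace_diff[OF subspace_cocycles pc subsetD[OF G.coboundaries_2_subset dm]])
  obtain D where D: "\<forall>x\<in>carrier N. \<forall>y\<in>carrier N. \<bar>\<mu> (x \<otimes>\<^bsub>N\<^esub> y) - \<mu> x - \<mu> y\<bar> \<le> D"
    using QNG_D(1)[OF \<mu>Q] by (rule hqm_defect)
  obtain M where M: "\<forall>xs. \<bar>b xs\<bar> \<le> M" using b(1) by (rule bcochainsE)
  have "\<beta> \<in> bcochains G 2"
  proof (rule bcochains_2I)
    show "\<beta> \<in> cochains G 2" using \<beta>c by (simp add: cocycles_def)
    fix x y assume xy: "x \<in> carrier G" "y \<in> carrier G"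
    have "\<beta> [x, y] = tau \<mu> [p x, p y] - b [p x, p y] - cobd G 1 (mus \<mu>) [x, y]"
      using xy unfolding \<beta>_def minus_apply by (simp add: pullback_def c_def)
    then show "\<bar>\<beta> [x, y]\<bar> \<le> 2 * D + M"
      using cobd_mus_approx[of \<mu>, OF D QNG_D(2,3)[OF \<mu>Q] xy] spec[OF M, of "[p x, p y]"] by linarith
  qed
  then have "\<beta> \<in> bcocycles G 2" using \<beta>c by (simp add: bcocycles_def cocycles_def)
  moreover have "pullback p G 2 c = \<beta> + cobd G 1 (mus \<mu>)" by (simp add: \<beta>_def)
  ultimately have "pullback p G 2 c \<in> ssum (bcocycles G 2) (coboundaries G 2)"
    unfolding ssum_iff using dm by blast
  moreover have "pullback p G 2 c \<in> ssum (pullback p G 2 ` cocycles Gm 2) (coboundaries G 2)"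
    by (rule subsetD[OF subset_ssum_left[OF subspace_coboundaries] imageI[OF c]])
  ultimately have "pullback p G 2 c \<in> comparison_image" by (simp add: comparison_image_def)
  moreover have "tau \<mu> - c = b" by (simp add: c_def)
  then have "transgression \<mu> (pullback p G 2 c)"
    unfolding transgression_def using c b(1) fs.subspace_0[OF subspace_coboundaries[of G 2]]
    by (intro bexI[of _ c]) (simp_all only: diff_self)
  ultimately show ?thesis by (rule bexI[where P = "transgression \<mu>", rotated])
qed

lemma transgression_surj:
  assumes "x \<in> comparison_image"
  shows "\<exists>\<mu>\<in>dtau_kernel. transgression \<mu> x"
proof -
  obtain \<alpha> \<beta> where \<alpha>: "\<alpha> \<in> bcocycles G 2" "\<beta> \<in> coboundaries G 2" and x1: "x = \<alpha> + \<beta>"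
    using assms unfolding comparison_image_def Int_iff ssum_iff by blast
  obtain c \<beta>' where c: "c \<in> cocycles Gm 2" "\<beta>' \<in> coboundaries G 2" and x2: "x = pullback p G 2 c + \<beta>'"
    using assms unfolding comparison_image_def Int_iff ssum_iff by blast
  \<comment> \<open>The two decompositions of \<open>x\<close>, bounded plus exact and pullback plus
    exact, are subtracted; the exact remainder is the one required by
    \<open>bounded_pullback_imp_tau\<close>.\<close>
  obtain \<phi> where \<phi>: "\<beta> - \<beta>' = cobd G 1 \<phi>"
    using fs.subspace_diff[OF subspace_coboundaries \<alpha>(2) c(2)] by (rule coboundaries_2E)
  have "pullback p G 2 c = x - \<beta>'" using x2 by simp
  also have "\<dots> = \<alpha> + (\<beta> - \<beta>')" using x1 by (simp add: add_diff_eq)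
  finally have eq: "pullback p G 2 c = \<alpha> + cobd G 1 \<phi>" unfolding \<phi> .
  have "\<alpha> \<in> bcochains G 2" using \<alpha>(1) by (simp add: bcocycles_def)
  then obtain \<mu> u b where \<mu>: "\<mu> \<in> QNG N G i" and u: "u \<in> cochains Gm 1" and b: "b \<in> bcochains Gm 2"
    and tau: "tau \<mu> = (c - cobd Gm 1 u) + b"
    using c(1) eq by (rule bounded_pullback_imp_tau)
  have c': "c - cobd Gm 1 u \<in> cocycles Gm 2"
    by (rule fs.subspace_diff[OF subspace_cocycles c(1)
          subsetD[OF Gm.coboundaries_2_subset coboundaries_2I[OF u]]])
  have "cobd G 1 (pullback p G 1 u) \<in> coboundaries G 2"
    by (rule coboundaries_2I[OF pullback_in_cochains])
  \<comment> \<open>Replacing \<open>c\<close> by \<open>c - \<delta>u\<close> changes the pullback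
    only by the coboundary of \<open>p^* u\<close>, so \<open>x\<close> still represents its
    class.\<close>
  from fs.subspace_add[OF subspace_coboundaries c(2) this]
  have "x - pullback p G 2 (c - cobd Gm 1 u) \<in> coboundaries G 2"
    unfolding pullback_diff pullback_cobd_1[OF G.is_monoid p_hom] x2 by (simp add: algebra_simps)
  moreover have "tau \<mu> - (c - cobd Gm 1 u) = b" unfolding tau by (rule add_diff_cancel_left')
  ultimately have "transgression \<mu> x"
    unfolding transgression_def using c' b by (intro bexI[of _ "c - cobd Gm 1 u"]) simp_all
  then show ?thesis using dtau_kernelI[OF \<mu> c' b tau] by (rule bexI)
qed

text \<open>One direction makes the induced map on the quotient by
  \<open>H^1(N)^G + i^* Q(G)\<close> well defined, the other makes it injective.\<close>

lemma transgression_kernel: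
  assumes "transgression \<mu> x" and \<mu>: "\<mu> \<in> QNG N G i"
  shows "\<mu> \<in> ssum (H1NG N G i) (restrQG N G i) \<longleftrightarrow> x \<in> bounded_pullbacks"
proof
  obtain c where c: "c \<in> cocycles Gm 2" and b: "tau \<mu> - c \<in> bcochains Gm 2"
    and x: "x - pullback p G 2 c \<in> coboundaries G 2"
    using assms(1) unfolding transgression_def by blast
  {
    assume "\<mu> \<in> ssum (H1NG N G i) (restrQG N G i)"
    then obtain h u b' where h: "h \<in> H1NG N G i" and u: "u \<in> cochains Gm 1"
      and b': "b' \<in> bcochains Gm 2" and tau: "tau \<mu> = (tau h - cobd Gm 1 u) + b'"
      by (rule ssum_tau)
    \<comment> \<open>A difference of cocycles that also equals \<open>b' - (tau \<mu> - c)\<close>,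
      hence is bounded. Its pullback is cohomologous to \<open>x\<close>, since
      \<open>\<tau>(h)\<close> and \<open>\<delta>u\<close> pull back to coboundaries.\<close>
    define e where "e = c - (tau h - cobd Gm 1 u)"
    have "tau h - cobd Gm 1 u \<in> cocycles Gm 2"
      by (rule fs.subspace_diff[OF subspace_cocycles H1NG_tau(1)[OF h]
            subsetD[OF Gm.coboundaries_2_subset coboundaries_2I[OF u]]])
    then have "e \<in> cocycles Gm 2"
      unfolding e_def by (rule fs.subspace_diff[OF subspace_cocycles c])
    moreover have "e = b' - (tau \<mu> - c)" unfolding e_def tau by (simp add: algebra_simps)
    then have "e \<in> bcochains Gm 2" using fs.subspace_diff[OF subspace_bcochains b' b] by (simp only:)
    ultimately have e: "e \<in> bcocycles Gm 2" by (simp add: bcocycles_def cocycles_def)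
    have "cobd G 1 (mus h) \<in> coboundaries G 2" "cobd G 1 (pullback p G 1 u) \<in> coboundaries G 2"
      by (rule coboundaries_2I[OF mus_in_cochains] coboundaries_2I[OF pullback_in_cochains])+
    then have "cobd G 1 (mus h) - cobd G 1 (pullback p G 1 u) \<in> coboundaries G 2"
      by (rule fs.subspace_diff[OF subspace_coboundaries])
    from fs.subspace_add[OF subspace_coboundaries x this]
    have xe: "x - pullback p G 2 e \<in> coboundaries G 2"
      unfolding e_def pullback_diff pullback_cobd_1[OF G.is_monoid p_hom] H1NG_tau(2)[OF h]
      by (simp add: algebra_simps)
    show "x \<in> bounded_pullbacks"
      unfolding bounded_pullbacks_def ssum_iff
    proof (intro bexI)
      show "x = pullback p G 2 e + (x - pullback p G 2 e)" by simp
    qed (rule xe imageI[OF e])+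
  next
    assume "x \<in> bounded_pullbacks"
    then obtain y \<beta> where y: "y \<in> pullback p G 2 ` bcocycles Gm 2"
      and \<beta>: "\<beta> \<in> coboundaries G 2" and x_eq: "x = y + \<beta>"
      unfolding bounded_pullbacks_def ssum_iff by blast
    from y obtain e where e: "e \<in> bcocycles Gm 2" and y_eq: "y = pullback p G 2 e"
      by (rule imageE)
    note xe = x_eq[unfolded y_eq]
    \<comment> \<open>This difference is \<open>p^* (c - e)\<close>, because
      \<open>x = p^* e + \<beta>\<close>; so the cocycle \<open>c - e\<close>, at bounded distance
      from \<open>\<tau>(\<mu>)\<close>, has an exact pullback.\<close>
    obtain \<phi> where \<phi>: "\<beta> - (x - pullback p G 2 c) = cobd G 1 \<phi>"
      using fs.subspace_diff[OF subspace_coboundaries \<beta> x] by (rule coboundaries_2E)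
    have ce: "c - e \<in> cocycles Gm 2"
      by (rule fs.subspace_diff[OF subspace_cocycles c subsetD[OF bcocycles_subset e]])
    have "e \<in> bcochains Gm 2" using e by (simp add: bcocycles_def)
    from fs.subspace_add[OF subspace_bcochains b this]
    have be: "(tau \<mu> - c) + e \<in> bcochains Gm 2" .
    have tau: "tau \<mu> = (c - e) + ((tau \<mu> - c) + e)" by simp
    have "pullback p G 2 (c - e) = cobd G 1 \<phi>"
      unfolding pullback_diff \<phi>[symmetric] xe by (simp add: algebra_simps)
    then show "\<mu> \<in> ssum (H1NG N G i) (restrQG N G i)"
      by (rule exact_pullback_imp_mem_ssum[OF \<mu> ce be tau])
  }
qed

lemma qdim_dtau_kernel:
  "(qdim dtau_kernel (ssum (H1NG N G i) (restrQG N G i)),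
    qdim comparison_image bounded_pullbacks) \<in> ordIso"
proof (rule qdim_ordIso_linear_relation[where R = transgression])
  show "fs.subspace (ssum (H1NG N G i) (restrQG N G i))"
    by (rule subspace_ssum[OF subspace_H1NG subspace_restrQG])
  show "transgression 0 0"
    unfolding transgression_def
  proof (intro bexI conjI)
    have "tau 0 = 0" "pullback p G 2 0 = 0"
      using tau_fscale[of 0 0] pullback_fscale[of p G 2 0 0] by (simp_all only: fs.scale_zero_left)
    then show "tau 0 - 0 \<in> bcochains Gm 2" "0 - pullback p G 2 0 \<in> coboundaries G 2"
      using fs.subspace_0[OF subspace_bcochains] fs.subspace_0[OF subspace_coboundaries]
      by (simp_all only: diff_zero)
  qed (rule fs.subspace_0[OF subspace_cocycles])
next
  fix x y x' y' assume "transgression x x'" "transgression y y'"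
  then obtain c d where *: "c \<in> cocycles Gm 2" "tau x - c \<in> bcochains Gm 2"
      "x' - pullback p G 2 c \<in> coboundaries G 2"
    and **: "d \<in> cocycles Gm 2" "tau y - d \<in> bcochains Gm 2" "y' - pullback p G 2 d \<in> coboundaries G 2"
    unfolding transgression_def by blast
  show "transgression (x + y) (x' + y')"
    unfolding transgression_def
  proof (intro bexI conjI)
    show "tau (x + y) - (c + d) \<in> bcochains Gm 2"
      using fs.subspace_add[OF subspace_bcochains *(2) **(2)] by (simp only: tau_add add_diff_add)
    show "x' + y' - pullback p G 2 (c + d) \<in> coboundaries G 2"
      using fs.subspace_add[OF subspace_coboundaries *(3) **(3)] by (simp only: pullback_add add_diff_add)
    show "c + d \<in> cocycles Gm 2"
      by (rule fs.subspace_add[OF subspace_cocycles *(1) **(1)])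
  qed
next
  fix k x x' assume "transgression x x'"
  then obtain c where *: "c \<in> cocycles Gm 2" "tau x - c \<in> bcochains Gm 2"
      "x' - pullback p G 2 c \<in> coboundaries G 2"
    unfolding transgression_def by blast
  show "transgression (fscale k x) (fscale k x')"
    unfolding transgression_def
  proof (intro bexI conjI)
    show "tau (fscale k x) - fscale k c \<in> bcochains Gm 2"
      using fs.subspace_scale[OF subspace_bcochains *(2), of k]
      by (simp only: tau_fscale fs.scale_right_diff_distrib)
    show "fscale k x' - pullback p G 2 (fscale k c) \<in> coboundaries G 2"
      using fs.subspace_scale[OF subspace_coboundaries *(3), of k]
      by (simp only: pullback_fscale fs.scale_right_diff_distrib)
    show "fscale k c \<in> cocycles Gm 2"
      by (rule fs.subspace_scale[OF subspace_cocycles *(1)])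
  qed
next
  fix x x' assume "transgression x x'" "x \<in> dtau_kernel"
  then show "x \<in> ssum (H1NG N G i) (restrQG N G i) \<longleftrightarrow> x' \<in> bounded_pullbacks"
    using transgression_kernel dtau_kernel_subset by (simp add: subset_eq)
qed (fact subspace_dtau_kernel ssum_subset_dtau_kernel subspace_bounded_pullbacks
    subspace_comparison_image bounded_pullbacks_subset | erule transgression_exists transgression_surj)+

text \<open>Additivity along \<open>U \<subseteq> K \<subseteq> Q(N)^G\<close> for
  \<open>U = H^1(N)^G + i^* Q(G)\<close> and \<open>K = dtau_kernel\<close>, with both quotients
  replaced by isomorphic ones.\<close>

lemma qdim_W:
  "(qdim (QNG N G i) (ssum (H1NG N G i) (restrQG N G i)),
    BNF_Cardinal_Arithmetic.csum
      (qdim (ssum (dtau ` QNG N G i) (bcoboundaries Gm 3)) (bcoboundaries Gm 3))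
      (qdim comparison_image bounded_pullbacks)) \<in> ordIso"
  by (rule ordIso_transitive[OF
        qdim_add[OF subspace_ssum[OF subspace_H1NG subspace_restrQG] subspace_dtau_kernel subspace_QNG
          ssum_subset_dtau_kernel dtau_kernel_subset]
        csum_cong[OF qdim_dtau_image qdim_dtau_kernel]])

text \<open>\<open>Im (d \<circ> \<tau>)\<close> is a subspace of \<open>Ker c^3\<close>, by
  \<open>dtau_in_bcocycles\<close>.\<close>

lemma qdim_dtau_image_le:
  "(qdim (ssum (dtau ` QNG N G i) (bcoboundaries Gm 3)) (bcoboundaries Gm 3),
    qdim (bcocycles Gm 3 \<inter> coboundaries Gm 3) (bcoboundaries Gm 3)) \<in> ordLeq"
proof (rule qdim_mono_left)
  have sI: "fs.subspace (dtau ` QNG N G i)"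
    by (intro subspace_linear_image subspace_QNG dtau_add dtau_fscale)
  show sB: "fs.subspace (bcoboundaries Gm 3)" by (rule subspace_bcoboundaries)
  show "fs.subspace (ssum (dtau ` QNG N G i) (bcoboundaries Gm 3))" by (rule subspace_ssum[OF sI sB])
  show "bcoboundaries Gm 3 \<subseteq> ssum (dtau ` QNG N G i) (bcoboundaries Gm 3)"
    by (rule subset_ssum_right[OF sI])
  show sC: "fs.subspace (bcocycles Gm 3 \<inter> coboundaries Gm 3)"
    by (rule fs.subspace_inter[OF subspace_bcocycles subspace_coboundaries])
  show "ssum (dtau ` QNG N G i) (bcoboundaries Gm 3) \<subseteq> bcocycles Gm 3 \<inter> coboundaries Gm 3"
    using dtau_in_bcocycles by (intro ssum_least[OF sC] image_subsetI Gm.bcoboundaries_3_subset)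
qed

text \<open>The second quotient is a subquotient of \<open>H^2(G)\<close>: both preimages lie
  between the coboundaries and the cocycles.\<close>

lemma qdim_comparison_image_le:
  "(qdim comparison_image bounded_pullbacks, qdim (cocycles G 2) (coboundaries G 2)) \<in> ordLeq"
  by (rule ordLeq_transitive[OF
        qdim_antimono_right[OF subspace_coboundaries subspace_bounded_pullbacks subspace_comparison_image
          coboundaries_subset_bounded_pullbacks bounded_pullbacks_subset]
        qdim_mono_left[OF subspace_coboundaries subspace_comparison_image subspace_cocycles
          subset_trans[OF coboundaries_subset_bounded_pullbacks bounded_pullbacks_subset]
          comparison_image_subset]])

end

theorem theorem7p11:
  fixes N :: "'n monoid" and G :: "'a monoid" and Gm :: "'c monoid"
    and i :: "'n \<Rightarrow> 'a" and p :: "'a \<Rightarrow> 'c" and s :: "'c \<Rightarrow> 'a"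
  assumes "group N" and "group G" and "group Gm"
    and "i \<in> hom N G" and "inj_on i (carrier N)"
    and "p \<in> hom G Gm" and "p ` carrier G = carrier Gm"
    and "i ` carrier N = kernel G Gm p"
    and "\<forall>\<gamma>\<in>carrier Gm. s \<gamma> \<in> carrier G \<and> p (s \<gamma>) = \<gamma>"
    and "s \<one>\<^bsub>Gm\<^esub> = \<one>\<^bsub>G\<^esub>"
  shows "(qdim (QNG N G i) (ssum (H1NG N G i) (restrQG N G i)),
          BNF_Cardinal_Arithmetic.csum (qdim (ssum (dtau_rep N G Gm i p s ` QNG N G i) (bcoboundaries Gm 3)) (bcoboundaries Gm 3))
          (qdim (ssum (bcocycles G 2) (coboundaries G 2) \<inter> ssum (pullback p G 2 ` cocycles Gm 2) (coboundaries G 2))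
               (ssum (pullback p G 2 ` bcocycles Gm 2) (coboundaries G 2))))
         \<in> ordIso
    \<and> (qdim (QNG N G i) (ssum (H1NG N G i) (restrQG N G i)),
          BNF_Cardinal_Arithmetic.csum (qdim (bcocycles Gm 3 \<inter> coboundaries Gm 3) (bcoboundaries Gm 3))
               (qdim (cocycles G 2) (coboundaries G 2)))
         \<in> ordLeq"
proof -
  interpret group_extension N G Gm i p s
    using assms by (simp add: group_extension_def group_extension_axioms_def)
  note eq = qdim_W
  have "(qdim (QNG N G i) (ssum (H1NG N G i) (restrQG N G i)),
      BNF_Cardinal_Arithmetic.csum (qdim (bcocycles Gm 3 \<inter> coboundaries Gm 3) (bcoboundaries Gm 3))
        (qdim (cocycles G 2) (coboundaries G 2))) \<in> ordLeq"
    by (rule ordIso_ordLeq_trans[OF eq csum_mono[OF qdim_dtau_image_le qdim_comparison_image_le]])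
  with eq show ?thesis
    unfolding comparison_image_def bounded_pullbacks_def by (rule conjI)
qed

end
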